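(* Let $f_\infty(x)=e^{-x}\mathbf 1_{\{x\ge 0\}}$ and $f_0(x)=2e^{-2x}\mathbf 1_{\{x\ge 0\}}$ be the pre-change and post-change densities, and let $\gamma_0=(1-\tfrac12\log 3)^{-1}\approx 2.2188$. Let $1<\gamma<\gamma_0$. (i) Let $A=A_\gamma>0$ be selected from the equation $$A+(\gamma-1)\sqrt{1+A}\,\log(1+A)-2(\gamma-1)\sqrt{1+A}=0,$$ and put $r_A=\sqrt{1+A}-1$. Then the SR-$r$ procedure $T_{\mathrm{sr}}^{r_A}(A)$ (threshold $A$, starting point $r_A$) satisfies $\mathsf E_\infty[T_{\mathrm{sr}}^{r_A}(A)]=\gamma$ and it is minimax, that is, $$\mathcal J_{\mathrm P}(T_{\mathrm{sr}}^{r_A}(A))=\inf_{\{T:\ \mathsf E_\infty T\ge\gamma\}}\mathcal J_{\mathrm P}(T),$$ where the infimum is over all stopping times $T$ adapted to the observations with $\mathsf E_\infty T\ge\gamma$. (ii) Let $B=B_\gamma=\exp\{2(\gamma-1)/\gamma\}-1$. Then the Shiryaev--Roberts--Pollak procedure $T_{\mathrm{srp}}(B)$ satisfies $\mathsf E_\infty[T_{\mathrm{srp}}(B)]=\gamma$ and $$\mathcal J_{\mathrm P}(T_{\mathrm{srp}}(B))>\mathcal J_{\mathrm P}(T_{\mathrm{sr}}^{r_A}(A)),$$ with $A$ and $r_A$ as in (i). Therefore the Shiryaev--Roberts--Pollak procedure is suboptimal (it does not attain the infimum in (i)).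
   Context: Changepoint model: $X_1,X_2,\dots$ are independent real observations. For a fixed changepoint $\nu\in\{0,1,2,\dots\}$, under $\mathsf P_\nu$ (expectation $\mathsf E_\nu$) the variables $X_1,\dots,X_\nu$ have density $f_\infty$ and $X_{\nu+1},X_{\nu+2},\dots$ have density $f_0$. Under $\mathsf P_\infty$ (expectation $\mathsf E_\infty$) all $X_n$ have density $f_\infty$. Write $\Lambda_n=f_0(X_n)/f_\infty(X_n)$ and $\mathscr F_n=\sigma(X_1,\dots,X_n)$ ($\mathscr F_0$ trivial). A detection procedure is a stopping time $T$ adapted to the observations, i.e. $\{T\le n\}\in\mathscr F_n$ for all $n$. Pollak's supremum average delay to detection is $$\mathcal J_{\mathrm P}(T)=\sup_{0\le\nu<\infty}\mathsf E_\nu(T-\nu\mid T>\nu),$$ where only those $\nu$ with $\mathsf P_\nu(T>\nu)=\mathsf P_\infty(T>\nu)>0$ are considered. SR-$r$ procedure: for $r\ge0$, $A>0$, let $R_0^r=r$, $R_n^r=(1+R_{n-1}^r)\Lambda_n$ for $n\ge1$, and $T_{\mathrm{sr}}^r(A)=\inf\{n\ge1: R_n^r\ge A\}$, with $\inf\varnothing=\infty$. For $r=0$ write $R_n=R_n^0$ and $T_{\mathrm{sr}}(A)=T_{\mathrm{sr}}^0(A)$ (the classical Shiryaev--Roberts procedure). Shiryaev--Roberts--Pollak (SRP) procedure: for $B>0$ let $\mathsf Q_B(x)=\lim_{n\to\infty}\mathsf P_\infty(R_n\le x\mid T_{\mathrm{sr}}(B)>n)$ be the quasi-stationary distribution of the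 Shiryaev--Roberts statistic. Let $R_0^{\mathsf Q_B}$ be a random variable with distribution $\mathsf Q_B$, independent of the observations (under every $\mathsf P_\nu$, $0\le\nu\le\infty$), let $R_n^{\mathsf Q_B}=(1+R_{n-1}^{\mathsf Q_B})\Lambda_n$ for $n\ge1$, and let $T_{\mathrm{srp}}(B)=\inf\{n\ge1: R_n^{\mathsf Q_B}\ge B\}$, with $\inf\varnothing=\infty$. For $T_{\mathrm{srp}}(B)$, the probabilities and expectations $\mathsf P_\nu,\mathsf E_\nu$ (and hence $\mathcal J_{\mathrm P}$) also average over the random initial value $R_0^{\mathsf Q_B}$. *)

theory Defs
  imports "HOL-Probability.Probability"
begin

text \<open>
  The observations are \<open>X n\<close> for \<open>n \<ge> 1\<close>; \<open>X 0\<close> plays no role.  The measure \<open>P \<nu>\<close> is the law with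
  changepoint \<open>\<nu>\<close>, where \<open>\<nu> = \<infinity>\<close> means that no change ever occurs.  All \<open>P \<nu>\<close> live on the same
  measurable space.
\<close>

locale changepoint_model =
  fixes P :: "enat \<Rightarrow> 'a measure" and X :: "nat \<Rightarrow> 'a \<Rightarrow> real"
    and f_inf f_0 :: "real \<Rightarrow> real"
  assumes prob: "\<And>\<nu>. prob_space (P \<nu>)"
    and sets_eq: "\<And>\<nu>. sets (P \<nu>) = sets (P \<infinity>)"
    and indep: "\<And>\<nu>. prob_space.indep_vars (P \<nu>) (\<lambda>_. borel) X {1..}"
    and dens: "\<And>\<nu> n. n \<ge> 1 \<Longrightarrow>
      distributed (P \<nu>) lborel (X n) (\<lambda>x. ennreal (if enat n \<le> \<nu> then f_inf x else f_0 x))"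

definition likelihood_ratio ::
    "(real \<Rightarrow> real) \<Rightarrow> (real \<Rightarrow> real) \<Rightarrow> (nat \<Rightarrow> 'a \<Rightarrow> real) \<Rightarrow> nat \<Rightarrow> 'a \<Rightarrow> real" where
  "likelihood_ratio f_inf f_0 X n \<omega> = f_0 (X n \<omega>) / f_inf (X n \<omega>)"

text \<open>
  The \<open>\<sigma>\<close>-algebra generated by \<open>X 1, \<dots>, X t\<close>, with \<open>t = \<infinity>\<close> allowed because stopping times are
  \<open>enat\<close>-valued.  At \<open>t = 0\<close> it is the trivial \<open>\<sigma>\<close>-algebra on \<open>\<Omega>\<close>; a supremum of
  \<open>vimage_algebra\<close>s would there have the empty set as its space and so put no constraint on
  \<open>{T \<le> 0}\<close>.
\<close>

definition obs_filtration :: "'a set \<Rightarrow> (nat \<Rightarrow> 'a \<Rightarrow> real) \<Rightarrow> enat \<Rightarrow> 'a measure" where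
  "obs_filtration \<Omega> X t =
     sigma \<Omega> {X i -` S \<inter> \<Omega> | i S. 1 \<le> i \<and> enat i \<le> t \<and> S \<in> sets borel}"

definition mean_time :: "'a measure \<Rightarrow> ('a \<Rightarrow> enat) \<Rightarrow> ennreal" where
  "mean_time M T = (\<integral>\<^sup>+\<omega>. ennreal_of_enat (T \<omega>) \<partial>M)"

definition cond_delay :: "'a measure \<Rightarrow> ('a \<Rightarrow> enat) \<Rightarrow> nat \<Rightarrow> ennreal" where
  "cond_delay M T \<nu> =
     (\<integral>\<^sup>+\<omega>. ennreal_of_enat (T \<omega> - enat \<nu>) * indicator {\<omega>. T \<omega> > enat \<nu>} \<omega> \<partial>M)
       / emeasure M {\<omega> \<in> space M. T \<omega> > enat \<nu>}"

definition pollak_delay :: "(enat \<Rightarrow> 'a measure) \<Rightarrow> ('a \<Rightarrow> enat) \<Rightarrow> ennreal" where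
  "pollak_delay P T =
     (SUP \<nu>\<in>{\<nu>::nat. emeasure (P (enat \<nu>)) {\<omega> \<in> space (P (enat \<nu>)). T \<omega> > enat \<nu>} > 0}.
        cond_delay (P (enat \<nu>)) T \<nu>)"

text \<open>\<open>L n \<omega>\<close> stands for the likelihood ratio of the \<open>n\<close>-th observation.\<close>

primrec SR_stat :: "(nat \<Rightarrow> 'a \<Rightarrow> real) \<Rightarrow> real \<Rightarrow> nat \<Rightarrow> 'a \<Rightarrow> real" where
  "SR_stat L r 0 \<omega> = r"
| "SR_stat L r (Suc n) \<omega> = (1 + SR_stat L r n \<omega>) * L (Suc n) \<omega>"

definition T_sr :: "(nat \<Rightarrow> 'a \<Rightarrow> real) \<Rightarrow> real \<Rightarrow> real \<Rightarrow> 'a \<Rightarrow> enat" where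
  "T_sr L r A \<omega> = Inf {enat n | n. n \<ge> 1 \<and> SR_stat L r n \<omega> \<ge> A}"

text \<open>\<open>M\<close> is the no-change law.\<close>

definition quasi_stationary ::
    "'a measure \<Rightarrow> (nat \<Rightarrow> 'a \<Rightarrow> real) \<Rightarrow> real \<Rightarrow> real measure \<Rightarrow> bool" where
  "quasi_stationary M L B Q \<longleftrightarrow> real_distribution Q \<and>
     (\<forall>x. (\<lambda>n. \<P>(\<omega> in M. SR_stat L 0 n \<omega> \<le> x \<bar> T_sr L 0 B \<omega> > enat n)) \<longlonglongrightarrow> cdf Q x)"

text \<open>
  An initial value with law \<open>Q\<close>, independent of the observations, is adjoined as the first
  coordinate of a product space.
\<close>

definition randomized :: "real measure \<Rightarrow> (enat \<Rightarrow> 'a measure) \<Rightarrow> enat \<Rightarrow> (real \<times> 'a) measure" where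
  "randomized Q P \<nu> = Q \<Otimes>\<^sub>M P \<nu>"

definition T_srp :: "(nat \<Rightarrow> 'a \<Rightarrow> real) \<Rightarrow> real \<Rightarrow> real \<times> 'a \<Rightarrow> enat" where
  "T_srp L B = (\<lambda>(r, \<omega>). T_sr L r B \<omega>)"

definition pre_density :: "real \<Rightarrow> real" where
  "pre_density x = exp (- x) * indicator {0..} x"

definition post_density :: "real \<Rightarrow> real" where
  "post_density x = 2 * exp (- 2 * x) * indicator {0..} x"

definition threshold_eq :: "real \<Rightarrow> real \<Rightarrow> bool" where
  "threshold_eq \<gamma> A \<longleftrightarrow>
     A + (\<gamma> - 1) * sqrt (1 + A) * ln (1 + A) - 2 * (\<gamma> - 1) * sqrt (1 + A) = 0"

end

theory Submission
  imports Defs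
begin

text \<open>
  Under \<open>P \<infinity>\<close> the likelihood ratio is uniform on \<open>(0, 2)\<close>.  Hence, for a threshold \<open>A \<le> 2\<close>, the
  statistic is uniform on \<open>(0, A)\<close> as soon as it has survived one step without a change, whatever its
  starting point.  The survival probabilities before and after the change are therefore geometric,
  with ratios \<open>p = ln (1 + A) / 2\<close> and \<open>q = (ln (1 + A) - A / (1 + A)) / 2\<close>; the quasi-stationary law is
  uniform on \<open>(0, B)\<close>, and with both starting points of the theorem the conditional delay does not
  depend on \<open>\<nu>\<close>: it is \<open>d A\<close>, respectively \<open>d B\<close>, with
  \<open>d A = 1 + A\<^sup>2 / (4 (1 + A) (1 - q))\<close>.

  For the lower bound let \<open>J\<close> be the Pollak delay of a stopping time \<open>T\<close>.  Summing
  \<open>E\<^sub>\<nu> (T - \<nu>)\<^sup>+ \<le> J P\<^sub>\<infinity> (T > \<nu>)\<close> over \<open>\<nu>\<close>, with additional weight \<open>r\<close> on \<open>\<nu> = 0\<close>, and changing the measure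
  gives \<open>J (r + E\<^sub>\<infinity> T) \<ge> E\<^sub>\<infinity> (\<Sum>n<T. 1 + R\<^sub>n)\<close>, where \<open>R\<close> starts at \<open>r\<close>.  The right-hand side is bounded
  below by \<open>\<lambda> E\<^sub>\<infinity> T - m r\<close>, where \<open>m\<close> is the explicit value function of an optimal stopping problem; for
  \<open>r = sqrt (1 + A) - 1\<close> and \<open>E\<^sub>\<infinity> T \<ge> \<gamma>\<close> this forces \<open>J \<ge> d A\<close>.

  Finally \<open>d\<close> is increasing, and \<open>A < B\<close> amounts to \<open>2 ln s < s - 1 / s\<close> for \<open>s = sqrt (1 + A)\<close>.
\<close>

section \<open>The filtration of the observations\<close>

context changepoint_model
begin

abbreviation obs :: "nat \<Rightarrow> 'a measure" where
  "obs n \<equiv> obs_filtration (space (P \<infinity>)) X (enat n)"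

lemma space_P: "space (P \<nu>) = space (P \<infinity>)"
  by (rule sets_eq_imp_space_eq[OF sets_eq])

lemma measurable_X [measurable]: "n \<ge> 1 \<Longrightarrow> X n \<in> borel_measurable (P \<nu>)"
  using dens[of n \<nu>] by (auto simp: distributed_def)

lemma space_obs [simp]: "space (obs n) = space (P \<infinity>)"
  unfolding obs_filtration_def by (rule space_measure_of) auto

text \<open>Regrouping the generators by index gives the form in which
  \<open>indep_sets_collect_sigma\<close> treats blocks of indices.\<close>

lemma sets_obs:
  "sets (obs n) = sigma_sets (space (P \<infinity>)) (\<Union>i\<in>{1..n}. {X i -` S \<inter> space (P \<infinity>) | S. S \<in> sets borel})"
proof -
  have "{X i -` S \<inter> space (P \<infinity>) | i S. 1 \<le> i \<and> enat i \<le> enat n \<and> S \<in> sets borel} =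
      (\<Union>i\<in>{1..n}. {X i -` S \<inter> space (P \<infinity>) | S. S \<in> sets borel})"
    by fastforce
  then show ?thesis
    unfolding obs_filtration_def by (subst sets_measure_of) auto
qed

lemma sets_obs_subset: "sets (obs n) \<subseteq> sets (P \<nu>)"
proof -
  have "X i -` S \<inter> space (P \<infinity>) \<in> sets (P \<nu>)" if "i \<ge> 1" "S \<in> sets borel" for i S
    using measurable_sets[OF measurable_X[OF that(1)] that(2), of \<nu>] by (simp add: space_P[of \<nu>])
  then show ?thesis
    unfolding sets_obs by (subst space_P[of \<nu>, symmetric]) (intro sets.sigma_sets_subset, auto)
qed

lemma sets_obs_mono: "m \<le> n \<Longrightarrow> sets (obs m) \<subseteq> sets (obs n)"
  unfolding sets_obs by (rule sigma_sets_mono') (intro UN_mono, auto)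

lemma measurable_obs:
  assumes "f \<in> measurable (obs n) N"
  shows "f \<in> measurable (P \<nu>) N"
  using measurable_mono[OF order_refl refl sets_obs_subset[of n \<nu>]] assms
  by (auto simp: space_P[of \<nu>])

lemma measurable_obs_mono:
  assumes "f \<in> measurable (obs m) N" "m \<le> n"
  shows "f \<in> measurable (obs n) N"
  using measurable_mono[OF order_refl refl sets_obs_mono[OF assms(2)]] assms(1)
  by auto

lemma measurable_X_obs: "1 \<le> i \<Longrightarrow> i \<le> n \<Longrightarrow> X i \<in> borel_measurable (obs n)"
  by (rule measurableI) (auto 4 4 simp: sets_obs intro!: sigma_sets.Basic bexI[of _ i])

text \<open>The index blocks \<open>{1..n}\<close> and \<open>{Suc n}\<close> are disjoint, and
  independence of intersection-stable generators passes to the sigma-algebras generated by disjoint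
  blocks.\<close>

lemma indep_obs_next:
  "prob_space.indep_set (P \<nu>) (sets (obs n)) {X (Suc n) -` S \<inter> space (P \<nu>) | S. S \<in> sets borel}"
proof -
  interpret prob_space "P \<nu>" by (rule prob)
  let ?E = "\<lambda>i. {X i -` S \<inter> space (P \<nu>) | S. S \<in> sets borel}"
  let ?I = "case_bool {1..n} {Suc n}"
  have "indep_sets ?E {1..}"
    using indep[of \<nu>] by (simp add: indep_vars_def2)
  then have "indep_sets ?E (\<Union>b\<in>UNIV. ?I b)"
    by (rule indep_sets_mono_index[rotated]) (auto split: bool.splits)
  then have "indep_sets (\<lambda>b. sigma_sets (space (P \<nu>)) (\<Union>i\<in>?I b. ?E i)) UNIV"
  proof (rule indep_sets_collect_sigma)
    show "Int_stable (?E i)" for i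
    proof (rule Int_stableI)
      fix a b assume "a \<in> ?E i" "b \<in> ?E i"
      then obtain S T where "S \<in> sets borel" "a = X i -` S \<inter> space (P \<nu>)"
        "T \<in> sets borel" "b = X i -` T \<inter> space (P \<nu>)" by auto
      then show "a \<inter> b \<in> ?E i"
        by (intro CollectI exI[of _ "S \<inter> T"]) auto
    qed
    show "disjoint_family_on ?I UNIV"
      by (auto simp: disjoint_family_on_def split: bool.splits)
  qed
  then have "indep_sets (case_bool (sets (obs n)) (?E (Suc n))) UNIV"
    by (rule indep_sets_mono_sets)
       (auto simp: sets_obs space_P[of \<nu>] split: bool.splits)
  then show ?thesis
    by (simp add: indep_set_def)
qed

text \<open>Past and next observation are independent, so their joint law is a product, and Tonelli
  integrates the next observation out against its density. The one-step computations below rest on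
  this.\<close>

lemma nn_integral_next:
  assumes g: "g \<in> borel_measurable (obs n \<Otimes>\<^sub>M borel)"
  shows "(\<integral>\<^sup>+\<omega>. g (\<omega>, X (Suc n) \<omega>) \<partial>P \<nu>) =
    (\<integral>\<^sup>+\<omega>. (\<integral>\<^sup>+x. g (\<omega>, x) * ennreal (if enat (Suc n) \<le> \<nu> then f_inf x else f_0 x) \<partial>lborel) \<partial>P \<nu>)"
proof -
  interpret prob_space "P \<nu>" by (rule prob)
  define d where "d = (\<lambda>x. ennreal (if enat (Suc n) \<le> \<nu> then f_inf x else f_0 x))"
  have D: "distributed (P \<nu>) lborel (X (Suc n)) d"
    using dens[of "Suc n" \<nu>] by (simp add: d_def)
  have d [measurable]: "d \<in> borel_measurable borel"
    using D by (simp add: distributed_def)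
  \<comment> \<open>The identity, as a random variable with values in the coarser space
    \<open>obs n\<close>, represents the past.\<close>
  have id: "(\<lambda>\<omega>. \<omega>) \<in> measurable (P \<nu>) (obs n)"
    by (rule measurable_obs[where n = n]) simp
  have X: "X (Suc n) \<in> borel_measurable (P \<nu>)" by simp
  have joint: "distr (P \<nu>) (obs n) (\<lambda>\<omega>. \<omega>) \<Otimes>\<^sub>M distr (P \<nu>) borel (X (Suc n)) =
      distr (P \<nu>) (obs n \<Otimes>\<^sub>M borel) (\<lambda>\<omega>. (\<omega>, X (Suc n) \<omega>))"
  proof (rule pair_measure_eqI)
    fix A B assume A: "A \<in> sets (distr (P \<nu>) (obs n) (\<lambda>\<omega>. \<omega>))"
      and B: "B \<in> sets (distr (P \<nu>) borel (X (Suc n)))"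
    have AP: "A \<in> sets (P \<nu>)" "A \<subseteq> space (P \<nu>)"
      using A sets_obs_subset[of n \<nu>] sets.sets_into_space[of A "obs n"] by (auto simp: space_P[of \<nu>])
    have "prob (A \<inter> (X (Suc n) -` B \<inter> space (P \<nu>))) = prob A * prob (X (Suc n) -` B \<inter> space (P \<nu>))"
      using A B by (intro indep_setD[OF indep_obs_next[of \<nu> n]]) auto
    moreover have "(\<lambda>\<omega>. (\<omega>, X (Suc n) \<omega>)) -` (A \<times> B) \<inter> space (P \<nu>) =
        A \<inter> (X (Suc n) -` B \<inter> space (P \<nu>))" using AP by auto
    moreover have "(\<lambda>\<omega>. \<omega>) -` A \<inter> space (P \<nu>) = A" using AP by auto
    ultimately show "emeasure (distr (P \<nu>) (obs n) (\<lambda>\<omega>. \<omega>)) A * emeasure (distr (P \<nu>) borel (X (Suc n))) B =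
        emeasure (distr (P \<nu>) (obs n \<Otimes>\<^sub>M borel) (\<lambda>\<omega>. (\<omega>, X (Suc n) \<omega>))) (A \<times> B)"
      using A B id X
      by (simp add: emeasure_distr measurable_Pair emeasure_eq_measure ennreal_mult)
  next
    show "sigma_finite_measure (distr (P \<nu>) (obs n) (\<lambda>\<omega>. \<omega>))"
      by (intro prob_space_imp_sigma_finite prob_space_distr id)
    show "sigma_finite_measure (distr (P \<nu>) borel (X (Suc n)))"
      by (intro prob_space_imp_sigma_finite prob_space_distr X)
    show "sets (distr (P \<nu>) (obs n) (\<lambda>\<omega>. \<omega>) \<Otimes>\<^sub>M distr (P \<nu>) borel (X (Suc n))) =
        sets (distr (P \<nu>) (obs n \<Otimes>\<^sub>M borel) (\<lambda>\<omega>. (\<omega>, X (Suc n) \<omega>)))"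
      by (simp cong: sets_pair_measure_cong)
  qed
  interpret D: prob_space "distr (P \<nu>) borel (X (Suc n))"
    by (rule prob_space_distr) simp
  have dX: "distr (P \<nu>) borel (X (Suc n)) = density lborel d"
    using D by (simp add: distributed_def cong: distr_cong)
  have "(\<integral>\<^sup>+\<omega>. g (\<omega>, X (Suc n) \<omega>) \<partial>P \<nu>) =
      (\<integral>\<^sup>+z. g z \<partial>distr (P \<nu>) (obs n \<Otimes>\<^sub>M borel) (\<lambda>\<omega>. (\<omega>, X (Suc n) \<omega>)))"
    by (subst nn_integral_distr) (auto intro!: measurable_Pair id X g)
  also have "\<dots> = (\<integral>\<^sup>+\<omega>. \<integral>\<^sup>+x. g (\<omega>, x) \<partial>distr (P \<nu>) borel (X (Suc n)) \<partial>distr (P \<nu>) (obs n) (\<lambda>\<omega>. \<omega>))"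
    unfolding joint[symmetric]
    by (subst D.nn_integral_fst[symmetric]) (use g in simp_all)
  also have "\<dots> = (\<integral>\<^sup>+\<omega>. \<integral>\<^sup>+x. g (\<omega>, x) \<partial>density lborel d \<partial>P \<nu>)"
    unfolding dX[symmetric]
    by (subst nn_integral_distr[OF id]) (use g in \<open>simp_all add: D.borel_measurable_nn_integral\<close>)
  also have "\<dots> = (\<integral>\<^sup>+\<omega>. \<integral>\<^sup>+x. g (\<omega>, x) * d x \<partial>lborel \<partial>P \<nu>)"
  proof (rule nn_integral_cong)
    fix \<omega> assume "\<omega> \<in> space (P \<nu>)"
    then have "(\<lambda>x. g (\<omega>, x)) \<in> borel_measurable borel"
      by (intro measurable_compose[OF _ g]) (simp add: space_P[of \<nu>])
    then show "(\<integral>\<^sup>+x. g (\<omega>, x) \<partial>density lborel d) = (\<integral>\<^sup>+x. g (\<omega>, x) * d x \<partial>lborel)"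
      by (subst nn_integral_density) (simp_all add: mult.commute)
  qed
  finally show ?thesis by (simp add: d_def)
qed

text \<open>A Doob-Dynkin factorisation through the past and the newest observation. It lets
  inductions on \<open>n\<close> peel off one observation at a time.\<close>

lemma measurable_obs_Suc_factor:
  assumes "g \<in> borel_measurable (obs (Suc n))"
  shows "\<exists>h\<in>borel_measurable (obs n \<Otimes>\<^sub>M borel). \<forall>\<omega>\<in>space (P \<infinity>). g \<omega> = (h (\<omega>, X (Suc n) \<omega>) :: ennreal)"
  using assms
proof (induction g rule: borel_measurable_induct)
  case (cong f g)
  then show ?case by simp
next
  case (set A)
  let ?\<Phi> = "\<lambda>\<omega>. (\<omega>, X (Suc n) \<omega>)"
  have in_vimage: "X i -` S \<inter> space (P \<infinity>) \<in> {?\<Phi> -` C \<inter> space (P \<infinity>) | C. C \<in> sets (obs n \<Otimes>\<^sub>M borel)}"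
    if i: "i \<in> {1..Suc n}" and S: "S \<in> sets borel" for i S
  proof (cases "i = Suc n")
    case True
    have "space (P \<infinity>) \<times> S \<in> sets (obs n \<Otimes>\<^sub>M borel)"
      using S sets.top[of "obs n"] by (intro pair_measureI) auto
    moreover have "X i -` S \<inter> space (P \<infinity>) = ?\<Phi> -` (space (P \<infinity>) \<times> S) \<inter> space (P \<infinity>)"
      using True by auto
    ultimately show ?thesis by blast
  next
    case False
    let ?B = "X i -` S \<inter> space (P \<infinity>)"
    have "X i \<in> borel_measurable (obs n)"
      using i False by (intro measurable_X_obs) auto
    from measurable_sets[OF this S] have "?B \<in> sets (obs n)" by simp
    then have "?B \<times> UNIV \<in> sets (obs n \<Otimes>\<^sub>M borel)"
      by (intro pair_measureI) auto
    moreover have "?B = ?\<Phi> -` (?B \<times> UNIV) \<inter> space (P \<infinity>)" by auto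
    ultimately show ?thesis by blast
  qed
  \<comment> \<open>Preimages under the pairing map form a sigma-algebra, so it suffices that every
    generator of \<open>obs (Suc n)\<close> is such a preimage.\<close>
  have vimage: "sets (vimage_algebra (space (P \<infinity>)) ?\<Phi> (obs n \<Otimes>\<^sub>M borel)) =
      {?\<Phi> -` C \<inter> space (P \<infinity>) | C. C \<in> sets (obs n \<Otimes>\<^sub>M borel)}"
    by (rule sets_vimage_algebra2) (auto simp: space_pair_measure)
  have "A \<in> sigma_sets (space (P \<infinity>)) (\<Union>i\<in>{1..Suc n}. {X i -` S \<inter> space (P \<infinity>) | S. S \<in> sets borel})"
    using set by (simp only: sets_obs)
  also have "\<dots> \<subseteq> sets (vimage_algebra (space (P \<infinity>)) ?\<Phi> (obs n \<Otimes>\<^sub>M borel))"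
  proof -
    have "sigma_sets (space (vimage_algebra (space (P \<infinity>)) ?\<Phi> (obs n \<Otimes>\<^sub>M borel)))
        (\<Union>i\<in>{1..Suc n}. {X i -` S \<inter> space (P \<infinity>) | S. S \<in> sets borel})
      \<subseteq> sets (vimage_algebra (space (P \<infinity>)) ?\<Phi> (obs n \<Otimes>\<^sub>M borel))"
    proof (rule sets.sigma_sets_subset, rule UN_least, rule subsetI)
      fix i Z assume "i \<in> {1..Suc n}" "Z \<in> {X i -` S \<inter> space (P \<infinity>) | S. S \<in> sets borel}"
      then show "Z \<in> sets (vimage_algebra (space (P \<infinity>)) ?\<Phi> (obs n \<Otimes>\<^sub>M borel))"
        unfolding vimage using in_vimage by blast
    qed
    then show ?thesis by simp
  qed
  finally have "A \<in> {?\<Phi> -` C \<inter> space (P \<infinity>) | C. C \<in> sets (obs n \<Otimes>\<^sub>M borel)}"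
    unfolding vimage .
  then obtain C where C: "C \<in> sets (obs n \<Otimes>\<^sub>M borel)" "A = ?\<Phi> -` C \<inter> space (P \<infinity>)" by blast
  show ?case
  proof (intro bexI[of _ "indicator C"] ballI)
    show "indicator A \<omega> = (indicator C (\<omega>, X (Suc n) \<omega>) :: ennreal)" if "\<omega> \<in> space (P \<infinity>)" for \<omega>
      using that unfolding C(2) by (simp split: split_indicator)
    show "indicator C \<in> borel_measurable (obs n \<Otimes>\<^sub>M borel)"
      using C(1) by (rule borel_measurable_indicator)
  qed
next
  case (mult u c)
  from mult.IH obtain h where h: "h \<in> borel_measurable (obs n \<Otimes>\<^sub>M borel)"
    "\<forall>\<omega>\<in>space (P \<infinity>). u \<omega> = h (\<omega>, X (Suc n) \<omega>)" by blast
  show ?case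
    by (intro bexI[of _ "\<lambda>z. c * h z"]) (use h in simp_all)
next
  case (add u v)
  from add.IH obtain h k where h: "h \<in> borel_measurable (obs n \<Otimes>\<^sub>M borel)"
    "\<forall>\<omega>\<in>space (P \<infinity>). u \<omega> = h (\<omega>, X (Suc n) \<omega>)"
    "k \<in> borel_measurable (obs n \<Otimes>\<^sub>M borel)"
    "\<forall>\<omega>\<in>space (P \<infinity>). v \<omega> = k (\<omega>, X (Suc n) \<omega>)" by blast
  show ?case
    by (intro bexI[of _ "\<lambda>z. k z + h z"]) (use h in simp_all)
next
  case (seq U)
  obtain h where h: "\<And>i. h i \<in> borel_measurable (obs n \<Otimes>\<^sub>M borel)"
    "\<And>i \<omega>. \<omega> \<in> space (P \<infinity>) \<Longrightarrow> U i \<omega> = h i (\<omega>, X (Suc n) \<omega>)"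
    using seq.IH by metis
  have [measurable]: "h i \<in> borel_measurable (obs n \<Otimes>\<^sub>M borel)" for i by (rule h)
  show ?case
  proof (intro bexI[of _ "\<lambda>z. SUP i. h i z"] ballI)
    show "(\<Squnion> (range U)) \<omega> = (SUP i. h i (\<omega>, X (Suc n) \<omega>))" if "\<omega> \<in> space (P \<infinity>)" for \<omega>
      using h(2)[OF that] by (simp add: image_comp)
  qed measurable
qed

text \<open>The sigma-algebra at time 0 consists of the empty set and the whole space. This starts
  the induction in \<open>nn_integral_before_change\<close>.\<close>

lemma measurable_obs_0_const:
  assumes "g \<in> borel_measurable (obs 0)"
  obtains c :: ennreal where "\<And>\<omega>. \<omega> \<in> space (P \<infinity>) \<Longrightarrow> g \<omega> = c"
proof -
  interpret prob_space "P \<infinity>" by (rule prob)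
  obtain \<omega>0 where \<omega>0: "\<omega>0 \<in> space (P \<infinity>)" using not_empty by auto
  have "g -` {g \<omega>0} \<inter> space (P \<infinity>) \<in> sets (obs 0)"
    using measurable_sets[OF assms, of "{g \<omega>0}"] by simp
  also have "\<dots> = {{}, space (P \<infinity>)}"
    by (simp add: sets_obs sigma_sets_empty_eq)
  finally have "g -` {g \<omega>0} \<inter> space (P \<infinity>) = space (P \<infinity>)" using \<omega>0 by auto
  then show ?thesis by (intro that[of "g \<omega>0"]) auto
qed

end

section \<open>The likelihood ratio\<close>

definition lr :: "real \<Rightarrow> real" where
  "lr x = post_density x / pre_density x"

lemma measurable_densities [measurable]:
  "pre_density \<in> borel_measurable borel" "post_density \<in> borel_measurable borel" "lr \<in> borel_measurable borel"
  unfolding lr_def[abs_def] pre_density_def[abs_def] post_density_def[abs_def] by measurable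

lemma density_nonneg [simp]: "0 \<le> pre_density x" "0 \<le> post_density x" "0 \<le> lr x"
  by (simp_all add: lr_def pre_density_def post_density_def)

text \<open>For negative \<open>x\<close> the quotient is 0 / 0, which is 0 by convention.\<close>

lemma lr_eq: "lr x = (if 0 \<le> x then 2 * exp (- x) else 0)"
proof -
  have "exp (- (2 * x)) = exp (- x) * exp (- x)" by (simp flip: exp_add)
  then show ?thesis by (simp add: lr_def pre_density_def post_density_def)
qed

lemma post_density_eq: "post_density x = lr x * pre_density x"
  by (simp add: lr_def pre_density_def post_density_def indicator_def)

text \<open>For 0 < a < 2 the event a < 2 exp (- x) means x < ln (2 / a), which has exponential
  probability 1 - a / 2: the upper tail of the uniform law on (0, 2). Finite measures on the line
  are determined by these tails.\<close>

lemma distr_lr: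
  "distr (density lborel pre_density) borel lr = density lborel (\<lambda>u. ennreal (1/2) * indicator {0<..<2} u)"
    (is "?M = ?N")
proof (rule measure_eqI_lessThan)
  have exp1: "(\<integral>\<^sup>+x. ennreal (exp (- x)) * indicator {0..} x \<partial>lborel) = ennreal (0 - (- exp (- 0)))"
  proof (rule nn_integral_FTC_atLeast)
    show "((\<lambda>x::real. - exp (- x)) \<longlongrightarrow> 0) at_top" by real_asymp
  qed (auto intro!: derivative_eq_intros)
  have M: "emeasure ?M {a<..} = (\<integral>\<^sup>+x. ennreal (pre_density x) * indicator {x. a < lr x} x \<partial>lborel)" for a
    by (simp add: emeasure_distr emeasure_density vimage_def)
  have N: "emeasure ?N {a<..} = ennreal (1/2) * emeasure lborel ({0<..<2} \<inter> {a<..})" for a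
    by (simp add: emeasure_density mult.assoc flip: indicator_inter_arith nn_integral_cmult_indicator)
  show eq: "emeasure ?M {a<..} = emeasure ?N {a<..}" for a
  proof -
    consider "a \<le> 0" | "0 < a" "a < 2" | "2 \<le> a" by linarith
    then show ?thesis
    proof cases
      case 1
      have "emeasure ?M {a<..} = (\<integral>\<^sup>+x. ennreal (exp (- x)) * indicator {0..} x \<partial>lborel)"
        unfolding M using 1
        by (intro nn_integral_cong)
           (auto simp: lr_eq pre_density_def indicator_def intro: le_less_trans)
      moreover have "{0<..<2} \<inter> {a<..} = {0<..<2::real}" using 1 by auto
      ultimately show ?thesis
        unfolding exp1 N using ennreal_mult[of "1/2" 2] by simp
    next
      case 2
      have iff: "a < 2 * exp (- x) \<longleftrightarrow> x < ln (2 / a)" for x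
      proof -
        have "a < 2 * exp (- x) \<longleftrightarrow> exp x < 2 / a"
          using 2 by (simp add: exp_minus field_simps)
        also have "\<dots> \<longleftrightarrow> exp x < exp (ln (2 / a))" using 2 by simp
        finally show ?thesis by simp
      qed
      have "emeasure ?M {a<..} = (\<integral>\<^sup>+x. ennreal (exp (- x)) * indicator {0..ln (2 / a)} x \<partial>lborel)"
        unfolding M
      \<comment> \<open>The event is open at its right end while the fundamental theorem needs a
        closed interval; the endpoint is null.\<close>
      proof (rule nn_integral_cong_AE, use AE_lborel_singleton[of "ln (2 / a)"] in eventually_elim)
        fix x :: real assume "x \<noteq> ln (2 / a)"
        then show "ennreal (pre_density x) * indicator {x. a < lr x} x =
            ennreal (exp (- x)) * indicator {0..ln (2 / a)} x"
          using 2 iff[of x] by (auto simp: lr_eq pre_density_def indicator_def)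
      qed
      also have "\<dots> = ennreal (- exp (- ln (2 / a)) - (- exp (- 0)))"
        by (rule nn_integral_FTC_Icc) (use 2 in \<open>auto intro!: derivative_eq_intros\<close>)
      also have "- exp (- ln (2 / a)) - (- exp (- 0)) = 1 - a / 2"
        using 2 by (simp add: exp_minus)
      also have "ennreal (1 - a / 2) = emeasure ?N {a<..}"
      proof -
        have "{0<..<2} \<inter> {a<..} = {a<..<2}" using 2 by auto
        then show ?thesis
          unfolding N using 2 ennreal_mult[of "1/2" "2 - a"] by (simp add: diff_divide_distrib)
      qed
      finally show ?thesis .
    next
      case 3
      have "lr x \<le> 2" for x by (simp add: lr_eq)
      then have "lr x \<le> a" for x using 3 order_trans by blast
      then have "emeasure ?M {a<..} = (\<integral>\<^sup>+x. 0 \<partial>(lborel :: real measure))"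
        unfolding M by (intro nn_integral_cong) (simp add: not_less)
      moreover have "{0<..<2} \<inter> {a<..} = {}" using 3 by auto
      ultimately show ?thesis unfolding N by simp
    qed
  qed
  show "emeasure ?M {a<..} < \<infinity>" for a
  proof -
    have "emeasure lborel ({0<..<2} \<inter> {a<..}) \<le> emeasure lborel {0<..<2::real}"
      by (intro emeasure_mono) auto
    then have "emeasure lborel ({0<..<2} \<inter> {a<..}) < top"
      by (rule le_less_trans) simp
    then have "ennreal (1/2) * emeasure lborel ({0<..<2} \<inter> {a<..}) < top"
      by (rule ennreal_mult_less_top[THEN iffD2, OF disjI2, OF disjI2, OF conjI[OF ennreal_less_top]])
    then show ?thesis unfolding eq N infinity_ennreal_def .
  qed
qed (simp only: sets_distr sets_density sets_lborel)+

lemma nn_integral_lr: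
  assumes [measurable]: "g \<in> borel_measurable borel"
  shows "(\<integral>\<^sup>+x. g (lr x) * ennreal (pre_density x) \<partial>lborel) =
    ennreal (1/2) * (\<integral>\<^sup>+u. g u * indicator {0<..<2} u \<partial>lborel)"
proof -
  have "(\<integral>\<^sup>+x. g (lr x) * ennreal (pre_density x) \<partial>lborel) =
      (\<integral>\<^sup>+u. g u \<partial>distr (density lborel pre_density) borel lr)"
    by (simp add: nn_integral_distr nn_integral_density mult.commute)
  also have "\<dots> = (\<integral>\<^sup>+u. ennreal (1/2) * (g u * indicator {0<..<2} u) \<partial>lborel)"
    unfolding distr_lr by (simp add: nn_integral_density mult_ac)
  finally show ?thesis by (simp add: nn_integral_cmult)
qed

text \<open>One step of the recursion: \<open>(1 + y) \<Lambda>\<close> is uniform on \<open>(0, 2 (1 + y))\<close> before the change, so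
  as long as \<open>A \<le> 2\<close> the part that falls below \<open>A\<close> depends on \<open>y\<close> only through its total mass.\<close>

lemma nn_integral_step_pre:
  assumes [measurable]: "h \<in> borel_measurable borel" and "0 \<le> y" "A \<le> 2"
  shows "(\<integral>\<^sup>+x. h ((1 + y) * lr x) * indicator {..<A} ((1 + y) * lr x) * ennreal (pre_density x) \<partial>lborel) =
    ennreal (1 / (2 * (1 + y))) * (\<integral>\<^sup>+x. h x * indicator {0<..<A} x \<partial>lborel)"
proof -
  have "(\<integral>\<^sup>+x. h ((1 + y) * lr x) * indicator {..<A} ((1 + y) * lr x) * ennreal (pre_density x) \<partial>lborel) =
      ennreal (1/2) * (\<integral>\<^sup>+u. h ((1 + y) * u) * indicator {..<A} ((1 + y) * u) * indicator {0<..<2} u \<partial>lborel)"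
    by (subst nn_integral_lr[where g = "\<lambda>u. h ((1 + y) * u) * indicator {..<A} ((1 + y) * u)"]) simp_all
  also have "(\<integral>\<^sup>+u. h ((1 + y) * u) * indicator {..<A} ((1 + y) * u) * indicator {0<..<2} u \<partial>lborel) =
      \<bar>1 / (1 + y)\<bar> * (\<integral>\<^sup>+x. h ((1 + y) * (0 + 1 / (1 + y) * x)) * indicator {..<A} ((1 + y) * (0 + 1 / (1 + y) * x))
        * indicator {0<..<2} (0 + 1 / (1 + y) * x) \<partial>lborel)"
    using assms(2) by (intro nn_integral_real_affine) auto
  also have "(\<lambda>x. h ((1 + y) * (0 + 1 / (1 + y) * x)) * indicator {..<A} ((1 + y) * (0 + 1 / (1 + y) * x))
        * indicator {0<..<2} (0 + 1 / (1 + y) * x)) = (\<lambda>x. h x * indicator {0<..<A} x)"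
  proof
    fix x
    have "(1 + y) * (0 + 1 / (1 + y) * x) = x" using assms(2) by simp
    moreover have "0 + 1 / (1 + y) * x \<in> {0<..<2} \<longleftrightarrow> 0 < x \<and> x < 2 * (1 + y)"
      using assms(2) by (auto simp: field_simps)
    \<comment> \<open>The range of \<open>(1 + y) * u\<close> reaches at least up to
      \<open>A\<close>, so the truncation leaves all of (0, A). This is where
      \<open>A \<le> 2\<close> enters.\<close>
    moreover have "A \<le> 2 * (1 + y)" using assms(2,3) by simp
    ultimately show "h ((1 + y) * (0 + 1 / (1 + y) * x)) * indicator {..<A} ((1 + y) * (0 + 1 / (1 + y) * x))
        * indicator {0<..<2} (0 + 1 / (1 + y) * x) = h x * indicator {0<..<A} x"
      by (simp only:) (auto simp: indicator_def)
  qed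
  finally show ?thesis
    using assms(2) ennreal_mult[of "1 / 2" "\<bar>1 / (1 + y)\<bar>"] by (simp only: mult.assoc[symmetric]) simp
qed

text \<open>Writing the post-change density as \<open>lr x * pre_density x\<close> turns this into a
  pre-change step for \<open>h x * x\<close> with an extra factor 1 / (1 + y). Below
  \<open>A\<close> the new value therefore has density proportional to x, whatever \<open>y\<close>
  is.\<close>

lemma nn_integral_step_post:
  assumes [measurable]: "h \<in> borel_measurable borel" and "0 \<le> y" "A \<le> 2"
  shows "(\<integral>\<^sup>+x. h ((1 + y) * lr x) * indicator {..<A} ((1 + y) * lr x) * ennreal (post_density x) \<partial>lborel) =
    ennreal (1 / (2 * (1 + y)^2)) * (\<integral>\<^sup>+x. h x * ennreal x * indicator {0<..<A} x \<partial>lborel)"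
proof -
  have "(\<integral>\<^sup>+x. h ((1 + y) * lr x) * indicator {..<A} ((1 + y) * lr x) * ennreal (post_density x) \<partial>lborel) =
      (\<integral>\<^sup>+x. ennreal (1 / (1 + y)) * ((h ((1 + y) * lr x) * ennreal ((1 + y) * lr x)) *
        indicator {..<A} ((1 + y) * lr x) * ennreal (pre_density x)) \<partial>lborel)"
  proof (rule nn_integral_cong)
    fix x
    have "ennreal (post_density x) = ennreal (1 / (1 + y)) * ennreal ((1 + y) * lr x) * ennreal (pre_density x)"
      using assms(2) by (simp add: post_density_eq flip: ennreal_mult)
    then show "h ((1 + y) * lr x) * indicator {..<A} ((1 + y) * lr x) * ennreal (post_density x) =
      ennreal (1 / (1 + y)) * ((h ((1 + y) * lr x) * ennreal ((1 + y) * lr x)) *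
        indicator {..<A} ((1 + y) * lr x) * ennreal (pre_density x))"
      by (simp add: mult_ac)
  qed
  also have "\<dots> = ennreal (1 / (1 + y)) * (ennreal (1 / (2 * (1 + y))) *
      (\<integral>\<^sup>+x. h x * ennreal x * indicator {0<..<A} x \<partial>lborel))"
    by (subst nn_integral_cmult, measurable)
       (subst nn_integral_step_pre[where h = "\<lambda>x. h x * ennreal x"], use assms in simp_all)
  finally show ?thesis
    using assms(2) ennreal_mult[of "1 / (1 + y)" "1 / (2 * (1 + y))"]
    by (simp only: mult.assoc[symmetric]) (simp add: power2_eq_square mult_ac)
qed

section \<open>The Shiryaev-Roberts statistic\<close>

text \<open>All later arguments use the stopping rule in this form. As the infimum of the empty set
  is \<infinity>, paths that never cross need no separate case.\<close>

lemma T_sr_gt_iff: "T_sr L r A \<omega> > enat n \<longleftrightarrow> (\<forall>k\<in>{1..n}. SR_stat L r k \<omega> < A)"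
proof -
  have "T_sr L r A \<omega> > enat n \<longleftrightarrow> enat (Suc n) \<le> T_sr L r A \<omega>"
    by (simp add: Suc_ile_eq)
  also have "\<dots> \<longleftrightarrow> (\<forall>k\<ge>1. A \<le> SR_stat L r k \<omega> \<longrightarrow> Suc n \<le> k)"
    unfolding T_sr_def le_Inf_iff by auto
  also have "\<dots> \<longleftrightarrow> (\<forall>k\<ge>1. k \<le> n \<longrightarrow> SR_stat L r k \<omega> < A)"
    by (intro all_cong) linarith
  also have "\<dots> \<longleftrightarrow> (\<forall>k\<in>{1..n}. SR_stat L r k \<omega> < A)"
    by auto
  finally show ?thesis .
qed

lemma T_sr_gt_Suc:
  "T_sr L r A \<omega> > enat (Suc n) \<longleftrightarrow> T_sr L r A \<omega> > enat n \<and> SR_stat L r (Suc n) \<omega> < A"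
  unfolding T_sr_gt_iff by (auto simp: le_Suc_eq simp del: SR_stat.simps)

locale exponential_model = changepoint_model P X pre_density post_density
  for P :: "enat \<Rightarrow> 'a measure" and X :: "nat \<Rightarrow> 'a \<Rightarrow> real"
begin

abbreviation L :: "nat \<Rightarrow> 'a \<Rightarrow> real" where
  "L \<equiv> likelihood_ratio pre_density post_density X"

abbreviation alive :: "real \<Rightarrow> real \<Rightarrow> nat \<Rightarrow> 'a set" where
  "alive r A n \<equiv> {\<omega>. T_sr L r A \<omega> > enat n}"

lemma L_eq: "L n \<omega> = lr (X n \<omega>)"
  by (simp add: likelihood_ratio_def lr_def)

lemma SR_nonneg: "0 \<le> r \<Longrightarrow> 0 \<le> SR_stat L r n \<omega>"
  by (induction n) (simp_all add: L_eq)

lemma measurable_SR: "SR_stat L r n \<in> borel_measurable (obs n)"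
proof (induction n)
  case (Suc n)
  have [measurable]: "SR_stat L r n \<in> borel_measurable (obs (Suc n))"
    by (rule measurable_obs_mono[OF Suc]) simp
  have [measurable]: "X (Suc n) \<in> borel_measurable (obs (Suc n))"
    by (rule measurable_X_obs) simp_all
  have "(\<lambda>\<omega>. (1 + SR_stat L r n \<omega>) * lr (X (Suc n) \<omega>)) \<in> borel_measurable (obs (Suc n))"
    by measurable
  then show ?case by (simp add: L_eq[of "Suc n"])
qed simp

text \<open>Joint measurability in start and path is needed once the start is random.\<close>

lemma measurable_SR_pair:
  "(\<lambda>(r, \<omega>). SR_stat L r n \<omega>) \<in> borel_measurable (borel \<Otimes>\<^sub>M P \<nu>)"
proof (induction n)
  case 0
  then show ?case by (simp add: case_prod_beta)
next
  case (Suc n)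
  have [measurable]: "(\<lambda>z. SR_stat L (fst z) n (snd z)) \<in> borel_measurable (borel \<Otimes>\<^sub>M P \<nu>)"
    using Suc by (simp add: case_prod_beta)
  have [measurable]: "X (Suc n) \<in> borel_measurable (P \<nu>)" by simp
  show ?case
    unfolding SR_stat.simps L_eq[of "Suc n"] case_prod_beta by measurable
qed

text \<open>The sets \<open>alive r A n\<close> are not cut down to the sample space, so
  measurability is stated for their indicators.\<close>

lemma measurable_alive: "n \<le> m \<Longrightarrow> (indicator (alive r A n) :: 'a \<Rightarrow> ennreal) \<in> borel_measurable (obs m)"
proof (induction n)
  case 0
  have "alive r A 0 = UNIV" by (simp add: T_sr_gt_iff)
  then show ?case by simp
next
  case (Suc n)
  have [measurable]: "SR_stat L r (Suc n) \<in> borel_measurable (obs m)"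
    by (rule measurable_obs_mono[OF measurable_SR Suc.prems])
  have [measurable]: "(indicator (alive r A n) :: 'a \<Rightarrow> ennreal) \<in> borel_measurable (obs m)"
    using Suc by simp
  have "(indicator (alive r A (Suc n)) :: 'a \<Rightarrow> ennreal) =
      (\<lambda>\<omega>. indicator (alive r A n) \<omega> * indicator {..<A} (SR_stat L r (Suc n) \<omega>))"
    by (auto simp: fun_eq_iff indicator_def T_sr_gt_Suc simp del: SR_stat.simps)
  also have "\<dots> \<in> borel_measurable (obs m)" by measurable
  finally show ?case .
qed

lemma alive_in_obs: "alive r A n \<inter> space (P \<infinity>) \<in> sets (obs n)"
  using measurable_alive[OF order_refl, of n r A] by (simp add: borel_measurable_indicator_iff Int_commute)

lemma stopping_time_T_sr: "stopping_time (obs_filtration (space (P \<infinity>)) X) (T_sr L r A)"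
  unfolding stopping_time_def
proof
  fix t :: enat
  show "Measurable.pred (obs_filtration (space (P \<infinity>)) X t) (\<lambda>\<omega>. T_sr L r A \<omega> \<le> t)"
  proof (cases t)
    case (enat n)
    have "{\<omega> \<in> space (obs n). T_sr L r A \<omega> \<le> enat n} = space (obs n) - (alive r A n \<inter> space (P \<infinity>))"
      by auto
    then show ?thesis
      unfolding enat using alive_in_obs[of n r A] by (simp add: pred_def sets.compl_sets[of _ "obs n", simplified])
  qed simp
qed

lemma nn_integral_next_alive:
  fixes h :: "real \<Rightarrow> ennreal"
  assumes [measurable]: "h \<in> borel_measurable borel"
  shows "(\<integral>\<^sup>+\<omega>. h (SR_stat L r (Suc n) \<omega>) * indicator (alive r A (Suc n)) \<omega> \<partial>P \<nu>) =
    (\<integral>\<^sup>+\<omega>. (\<integral>\<^sup>+x. h ((1 + SR_stat L r n \<omega>) * lr x) * indicator {..<A} ((1 + SR_stat L r n \<omega>) * lr x) *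
      ennreal (if enat (Suc n) \<le> \<nu> then pre_density x else post_density x) \<partial>lborel) *
      indicator (alive r A n) \<omega> \<partial>P \<nu>)"
proof -
  define g where "g = (\<lambda>(\<omega>, x). h ((1 + SR_stat L r n \<omega>) * lr x) *
    indicator {..<A} ((1 + SR_stat L r n \<omega>) * lr x) * indicator (alive r A n) \<omega>)"
  note [measurable] = measurable_SR[of r n]
  have g [measurable]: "g \<in> borel_measurable (obs n \<Otimes>\<^sub>M borel)"
    unfolding g_def case_prod_beta
    by (intro borel_measurable_times_ennreal measurable_compose[OF measurable_fst measurable_alive[OF order_refl]])
       measurable
  have "(\<integral>\<^sup>+\<omega>. h (SR_stat L r (Suc n) \<omega>) * indicator (alive r A (Suc n)) \<omega> \<partial>P \<nu>) =
      (\<integral>\<^sup>+\<omega>. g (\<omega>, X (Suc n) \<omega>) \<partial>P \<nu>)"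
    by (intro nn_integral_cong) (auto simp: g_def indicator_def T_sr_gt_Suc L_eq)
  also have "\<dots> = (\<integral>\<^sup>+\<omega>. (\<integral>\<^sup>+x. g (\<omega>, x) *
      ennreal (if enat (Suc n) \<le> \<nu> then pre_density x else post_density x) \<partial>lborel) \<partial>P \<nu>)"
    by (rule nn_integral_next[OF g])
  also have "\<dots> = (\<integral>\<^sup>+\<omega>. (\<integral>\<^sup>+x. h ((1 + SR_stat L r n \<omega>) * lr x) * indicator {..<A} ((1 + SR_stat L r n \<omega>) * lr x) *
      ennreal (if enat (Suc n) \<le> \<nu> then pre_density x else post_density x) \<partial>lborel) *
      indicator (alive r A n) \<omega> \<partial>P \<nu>)"
    by (intro nn_integral_cong) (simp add: g_def indicator_def)
  finally show ?thesis .
qed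

text \<open>By \<open>nn_integral_step_pre\<close> the current value enters only through a scalar
  factor, so the integral splits: on survival the new statistic is spread as Lebesgue measure on (0,
  A), and the past contributes only a mass.\<close>

lemma nn_integral_alive_pre:
  fixes h :: "real \<Rightarrow> ennreal"
  assumes [measurable]: "h \<in> borel_measurable borel"
    and "enat (Suc n) \<le> \<nu>" "0 \<le> r" "A \<le> 2"
  shows "(\<integral>\<^sup>+\<omega>. h (SR_stat L r (Suc n) \<omega>) * indicator (alive r A (Suc n)) \<omega> \<partial>P \<nu>) =
    (\<integral>\<^sup>+x. h x * indicator {0<..<A} x \<partial>lborel) *
    (\<integral>\<^sup>+\<omega>. ennreal (1 / (2 * (1 + SR_stat L r n \<omega>))) * indicator (alive r A n) \<omega> \<partial>P \<nu>)"
proof -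
  note [measurable] = measurable_obs[OF measurable_SR[of r n]]
  show ?thesis
    unfolding nn_integral_next_alive[OF assms(1)]
    by (subst nn_integral_cmult[symmetric],
        intro borel_measurable_times_ennreal measurable_obs[OF measurable_alive[OF order_refl]], measurable)
       (simp add: nn_integral_step_pre[OF assms(1) SR_nonneg[OF assms(3), of n] assms(4)] assms(2), simp only: mult_ac)
qed

text \<open>The same splitting after the change, with density x instead of 1 on (0, A).\<close>

lemma nn_integral_alive_post:
  fixes h :: "real \<Rightarrow> ennreal"
  assumes [measurable]: "h \<in> borel_measurable borel"
    and "\<not> enat (Suc n) \<le> \<nu>" "0 \<le> r" "A \<le> 2"
  shows "(\<integral>\<^sup>+\<omega>. h (SR_stat L r (Suc n) \<omega>) * indicator (alive r A (Suc n)) \<omega> \<partial>P \<nu>) =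
    (\<integral>\<^sup>+x. h x * ennreal x * indicator {0<..<A} x \<partial>lborel) *
    (\<integral>\<^sup>+\<omega>. ennreal (1 / (2 * (1 + SR_stat L r n \<omega>)^2)) * indicator (alive r A n) \<omega> \<partial>P \<nu>)"
proof -
  note [measurable] = measurable_obs[OF measurable_SR[of r n]]
  show ?thesis
    unfolding nn_integral_next_alive[OF assms(1)]
    by (subst nn_integral_cmult[symmetric],
        intro borel_measurable_times_ennreal measurable_obs[OF measurable_alive[OF order_refl]], measurable)
       (simp add: nn_integral_step_post[OF assms(1) SR_nonneg[OF assms(3), of n] assms(4)] assms(2), simp only: mult_ac)
qed

text \<open>Up to the change, both laws integrate each observation against the same density; the
  induction peels off the last one.\<close>

lemma nn_integral_before_change:
  assumes "g \<in> borel_measurable (obs n)" "enat n \<le> \<nu>"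
  shows "(\<integral>\<^sup>+\<omega>. g \<omega> \<partial>P \<nu>) = (\<integral>\<^sup>+\<omega>. (g \<omega> :: ennreal) \<partial>P \<infinity>)"
  using assms
proof (induction n arbitrary: g)
  case 0
  from measurable_obs_0_const[OF this(1)] obtain c where c: "\<And>\<omega>. \<omega> \<in> space (P \<infinity>) \<Longrightarrow> g \<omega> = c"
    by metis
  have "(\<integral>\<^sup>+\<omega>. g \<omega> \<partial>P \<mu>) = c" for \<mu>
  proof -
    interpret prob_space "P \<mu>" by (rule prob)
    have "(\<integral>\<^sup>+\<omega>. g \<omega> \<partial>P \<mu>) = (\<integral>\<^sup>+\<omega>. c \<partial>P \<mu>)"
      by (intro nn_integral_cong) (simp add: c space_P[of \<mu>])
    then show ?thesis by (simp add: emeasure_space_1)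
  qed
  then show ?case by simp
next
  case (Suc n)
  from measurable_obs_Suc_factor[OF Suc.prems(1)] obtain h where
    h [measurable]: "h \<in> borel_measurable (obs n \<Otimes>\<^sub>M borel)" and
    g: "\<And>\<omega>. \<omega> \<in> space (P \<infinity>) \<Longrightarrow> g \<omega> = h (\<omega>, X (Suc n) \<omega>)" by blast
  have *: "(\<integral>\<^sup>+\<omega>. g \<omega> \<partial>P \<mu>) = (\<integral>\<^sup>+\<omega>. (\<integral>\<^sup>+x. h (\<omega>, x) * ennreal (pre_density x) \<partial>lborel) \<partial>P \<mu>)"
    if "enat (Suc n) \<le> \<mu>" for \<mu>
  proof -
    have "(\<integral>\<^sup>+\<omega>. g \<omega> \<partial>P \<mu>) = (\<integral>\<^sup>+\<omega>. h (\<omega>, X (Suc n) \<omega>) \<partial>P \<mu>)"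
      by (intro nn_integral_cong) (simp add: g space_P[of \<mu>])
    then show ?thesis using that by (simp add: nn_integral_next)
  qed
  have "enat n \<le> \<nu>" using Suc.prems(2) by (meson Suc_ile_eq order_less_imp_le)
  then have "(\<integral>\<^sup>+\<omega>. (\<integral>\<^sup>+x. h (\<omega>, x) * ennreal (pre_density x) \<partial>lborel) \<partial>P \<nu>) =
      (\<integral>\<^sup>+\<omega>. (\<integral>\<^sup>+x. h (\<omega>, x) * ennreal (pre_density x) \<partial>lborel) \<partial>P \<infinity>)"
    by (intro Suc.IH) measurable
  then show ?case using *[OF Suc.prems(2)] *[of \<infinity>] by simp
qed

text \<open>The statistic \<open>R\<^sub>n\<close> is the density, on the first \<open>n\<close> observations, of the sum of the laws
  with changepoint before \<open>n\<close>, the one at \<open>0\<close> being counted with the additional weight \<open>r\<close>.\<close>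

lemma nn_integral_SR:
  assumes "g \<in> borel_measurable (obs n)" "0 \<le> r"
  shows "ennreal r * (\<integral>\<^sup>+\<omega>. g \<omega> \<partial>P 0) + (\<Sum>k<n. \<integral>\<^sup>+\<omega>. g \<omega> \<partial>P (enat k)) =
    (\<integral>\<^sup>+\<omega>. ennreal (SR_stat L r n \<omega>) * (g \<omega> :: ennreal) \<partial>P \<infinity>)"
  using assms(1)
proof (induction n arbitrary: g)
  case 0
  have [measurable]: "g \<in> borel_measurable (P \<infinity>)" by (rule measurable_obs[OF 0])
  show ?case
    using nn_integral_before_change[OF 0, of 0] by (simp add: nn_integral_cmult zero_enat_def)
next
  case (Suc n)
  from measurable_obs_Suc_factor[OF Suc.prems] obtain h where
    h [measurable]: "h \<in> borel_measurable (obs n \<Otimes>\<^sub>M borel)" and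
    g: "\<And>\<omega>. \<omega> \<in> space (P \<infinity>) \<Longrightarrow> g \<omega> = h (\<omega>, X (Suc n) \<omega>)" by blast
  \<comment> \<open>\<open>k\<close> averages observation n + 1 out of \<open>g\<close> with the
    post-change density. This is correct for every changepoint up to n, so one \<open>k\<close>
    serves all summands.\<close>
  define k where "k = (\<lambda>\<omega>. \<integral>\<^sup>+x. h (\<omega>, x) * ennreal (post_density x) \<partial>lborel)"
  have k [measurable]: "k \<in> borel_measurable (obs n)" unfolding k_def by measurable
  note [measurable] = measurable_SR[of r n]
  have *: "(\<integral>\<^sup>+\<omega>. g \<omega> \<partial>P \<mu>) = (\<integral>\<^sup>+\<omega>. k \<omega> \<partial>P \<mu>)" if "\<mu> \<le> enat n" for \<mu>
  proof -
    have "\<not> enat (Suc n) \<le> \<mu>" using that by (cases \<mu>) auto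
    moreover have "(\<integral>\<^sup>+\<omega>. g \<omega> \<partial>P \<mu>) = (\<integral>\<^sup>+\<omega>. h (\<omega>, X (Suc n) \<omega>) \<partial>P \<mu>)"
      by (intro nn_integral_cong) (simp add: g space_P[of \<mu>])
    ultimately show ?thesis by (simp add: nn_integral_next k_def)
  qed
  \<comment> \<open>On the first n observations the law with changepoint n agrees with the no-change
    law; its term supplies the 1 in the factor \<open>1 + SR_stat L r n \<omega>\<close>.\<close>
  have "ennreal r * (\<integral>\<^sup>+\<omega>. g \<omega> \<partial>P 0) + (\<Sum>k<Suc n. \<integral>\<^sup>+\<omega>. g \<omega> \<partial>P (enat k)) =
      (\<integral>\<^sup>+\<omega>. ennreal (SR_stat L r n \<omega>) * k \<omega> \<partial>P \<infinity>) + (\<integral>\<^sup>+\<omega>. k \<omega> \<partial>P \<infinity>)"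
    using * Suc.IH[OF k] nn_integral_before_change[OF k, of "enat n"]
    by (simp flip: add.assoc)
  also have "\<dots> = (\<integral>\<^sup>+\<omega>. ennreal (1 + SR_stat L r n \<omega>) * k \<omega> \<partial>P \<infinity>)"
  proof -
    note [measurable] = measurable_obs[OF k] measurable_obs[OF measurable_SR[of r n]]
    show ?thesis
      using SR_nonneg[OF assms(2), of n]
      by (subst nn_integral_add[symmetric]) (auto simp: distrib_right add.commute)
  qed
  also have "\<dots> = (\<integral>\<^sup>+\<omega>. (\<integral>\<^sup>+x. (ennreal (1 + SR_stat L r n \<omega>) * ennreal (lr x) * h (\<omega>, x)) *
      ennreal (pre_density x) \<partial>lborel) \<partial>P \<infinity>)"
  proof (rule nn_integral_cong)
    fix \<omega> assume "\<omega> \<in> space (P \<infinity>)"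
    then have [measurable]: "(\<lambda>x. h (\<omega>, x)) \<in> borel_measurable borel"
      by (intro measurable_compose[OF _ h]) simp
    show "ennreal (1 + SR_stat L r n \<omega>) * k \<omega> = (\<integral>\<^sup>+x. (ennreal (1 + SR_stat L r n \<omega>) * ennreal (lr x) * h (\<omega>, x)) *
      ennreal (pre_density x) \<partial>lborel)"
      unfolding k_def by (subst nn_integral_cmult[symmetric]) (simp_all add: post_density_eq ennreal_mult mult_ac)
  qed
  also have "\<dots> = (\<integral>\<^sup>+\<omega>. ennreal (1 + SR_stat L r n \<omega>) * ennreal (lr (X (Suc n) \<omega>)) * h (\<omega>, X (Suc n) \<omega>) \<partial>P \<infinity>)"
    using nn_integral_next[of "\<lambda>(\<omega>, x). ennreal (1 + SR_stat L r n \<omega>) * ennreal (lr x) * h (\<omega>, x)" n \<infinity>]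
    by simp
  also have "\<dots> = (\<integral>\<^sup>+\<omega>. ennreal (SR_stat L r (Suc n) \<omega>) * g \<omega> \<partial>P \<infinity>)"
    using SR_nonneg[OF assms(2), of n]
    by (intro nn_integral_cong) (simp add: g L_eq ennreal_mult)
  finally show ?case .
qed

end

section \<open>Run lengths and delays\<close>

lemma ennreal_of_enat_diff_eq_suminf:
  "ennreal_of_enat (t - enat \<nu>) * of_bool (t > enat \<nu>) = (\<Sum>n. of_bool (t > enat (\<nu> + n)))"
proof (cases t)
  case (enat m)
  have "(\<Sum>n. of_bool (t > enat (\<nu> + n)) :: ennreal) = (\<Sum>n<m - \<nu>. of_bool (t > enat (\<nu> + n)))"
    using enat by (intro suminf_finite) auto
  also have "\<dots> = (\<Sum>n<m - \<nu>. 1)" using enat by (intro sum.cong) auto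
  finally show ?thesis using enat by auto
next
  case infinity
  have "(\<Sum>n. 1 :: ennreal) = (\<integral>\<^sup>+n. 1 \<partial>count_space (UNIV :: nat set))"
    by (simp only: nn_integral_count_space_nat)
  then show ?thesis using infinity by simp
qed

lemma nn_integral_delay_eq_suminf:
  assumes "\<And>n. {\<omega> \<in> space M. T \<omega> > enat n} \<in> sets M"
  shows "(\<integral>\<^sup>+\<omega>. ennreal_of_enat (T \<omega> - enat \<nu>) * indicator {\<omega>. T \<omega> > enat \<nu>} \<omega> \<partial>M) =
    (\<Sum>n. emeasure M {\<omega> \<in> space M. T \<omega> > enat (\<nu> + n)})"
proof -
  have "(\<integral>\<^sup>+\<omega>. ennreal_of_enat (T \<omega> - enat \<nu>) * indicator {\<omega>. T \<omega> > enat \<nu>} \<omega> \<partial>M) =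
      (\<integral>\<^sup>+\<omega>. (\<Sum>n. indicator {\<omega> \<in> space M. T \<omega> > enat (\<nu> + n)} \<omega>) \<partial>M)"
  proof (rule nn_integral_cong)
    fix \<omega> assume "\<omega> \<in> space M"
    then show "ennreal_of_enat (T \<omega> - enat \<nu>) * indicator {\<omega>. T \<omega> > enat \<nu>} \<omega> =
        (\<Sum>n. indicator {\<omega> \<in> space M. T \<omega> > enat (\<nu> + n)} \<omega>)"
      unfolding indicator_def using ennreal_of_enat_diff_eq_suminf[of "T \<omega>" \<nu>] by (simp only: mem_Collect_eq simp_thms)
  qed
  also have "\<dots> = (\<Sum>n. \<integral>\<^sup>+\<omega>. indicator {\<omega> \<in> space M. T \<omega> > enat (\<nu> + n)} \<omega> \<partial>M)"
    using assms by (intro nn_integral_suminf borel_measurable_indicator)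
  also have "\<dots> = (\<Sum>n. emeasure M {\<omega> \<in> space M. T \<omega> > enat (\<nu> + n)})"
    using assms by (simp add: nn_integral_indicator)
  finally show ?thesis .
qed

lemma mean_time_eq_suminf:
  assumes "\<And>n. {\<omega> \<in> space M. T \<omega> > enat n} \<in> sets M"
  shows "mean_time M T = (\<Sum>n. emeasure M {\<omega> \<in> space M. T \<omega> > enat n})"
proof -
  have "mean_time M T = (\<integral>\<^sup>+\<omega>. ennreal_of_enat (T \<omega> - enat 0) * indicator {\<omega>. T \<omega> > enat 0} \<omega> \<partial>M)"
    unfolding mean_time_def by (intro nn_integral_cong) (auto simp: indicator_def simp flip: zero_enat_def)
  then show ?thesis unfolding nn_integral_delay_eq_suminf[OF assms] by simp
qed

text \<open>The first term is kept apart because the first step after the start, or after the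
  change, has its own survival probability; only later steps follow the geometric ratio.\<close>

lemma suminf_ennreal_geometric_tail:
  assumes "f 0 = ennreal s" "\<And>j. f (Suc j) = ennreal (c * q ^ j)"
    and "0 \<le> s" "0 \<le> c" "0 \<le> q" "q < 1"
  shows "(\<Sum>n. f n) = ennreal (s + c / (1 - q))"
proof -
  define g where "g n = (case n of 0 \<Rightarrow> s | Suc j \<Rightarrow> c * q ^ j)" for n
  have "(\<lambda>j. g (Suc j)) sums (c * (1 / (1 - q)))"
    unfolding g_def nat.case using assms by (intro sums_mult geometric_sums) simp
  from sums_Suc[OF this] have "g sums (s + c / (1 - q))"
    by (simp add: g_def[of 0] add.commute)
  moreover have "f = (\<lambda>n. ennreal (g n))"
    using assms(1,2) by (auto simp: fun_eq_iff g_def split: nat.split)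
  moreover have "0 \<le> g n" for n using assms by (auto simp: g_def split: nat.split)
  ultimately show ?thesis by (simp only: suminf_ennreal_eq)
qed

section \<open>Survival ratios of the truncated recursion and their integrals\<close>

definition surv_pre :: "real \<Rightarrow> real" where
  "surv_pre A = ln (1 + A) / 2"

text \<open>The probability of surviving one post-change step from the density proportional to x on
  (0, A), which is the shape that every survived post-change step leaves behind.\<close>

definition surv_post :: "real \<Rightarrow> real" where
  "surv_post A = (ln (1 + A) - A / (1 + A)) / 2"

text \<open>The factor \<open>A\<^sup>2 / (4 * (1 + A))\<close> is the probability of surviving the
  first post-change step from a uniform position on (0, A), and equally from a point
  \<open>r\<close> with (1 + r)^2 = 1 + A. Each further step multiplies by
  \<open>surv_post A\<close>.\<close>

definition sr_delay :: "real \<Rightarrow> real" where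
  "sr_delay A = 1 + A\<^sup>2 / (4 * (1 + A)) / (1 - surv_post A)"

lemma nn_integral_Ioo_FTC:
  assumes [measurable]: "f \<in> borel_measurable borel" and "(0::real) \<le> A"
    and "\<And>x. 0 \<le> x \<Longrightarrow> x \<le> A \<Longrightarrow> (F has_real_derivative f x) (at x)"
    and "\<And>x. 0 \<le> x \<Longrightarrow> x \<le> A \<Longrightarrow> 0 \<le> f x"
  shows "(\<integral>\<^sup>+x. ennreal (f x) * indicator {0<..<A} x \<partial>lborel) = ennreal (F A - F 0)"
proof -
  have "(\<integral>\<^sup>+x. ennreal (f x) * indicator {0<..<A} x \<partial>lborel) = (\<integral>\<^sup>+x. ennreal (f x) * indicator {0..A} x \<partial>lborel)"
  proof (rule nn_integral_cong_AE, use AE_lborel_singleton[of 0] AE_lborel_singleton[of A] in eventually_elim)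
    fix x assume "x \<noteq> 0" "x \<noteq> A"
    then have "x \<in> {0<..<A} \<longleftrightarrow> x \<in> {0..A}" by auto
    then show "ennreal (f x) * indicator {0<..<A} x = ennreal (f x) * indicator {0..A} x"
      by (simp only: indicator_def)
  qed
  also have "\<dots> = ennreal (F A - F 0)"
    using assms by (intro nn_integral_FTC_Icc) auto
  finally show ?thesis .
qed

context
  fixes A :: real
  assumes A: "0 \<le> A"
begin

lemma nn_integral_Ioo_const: "(\<integral>\<^sup>+x. ennreal c * indicator {0<..<A} x \<partial>lborel) = ennreal c * ennreal A"
  using A by (simp add: nn_integral_cmult)

lemma nn_integral_Ioo_id: "(\<integral>\<^sup>+x. ennreal x * indicator {0<..<A} x \<partial>lborel) = ennreal (A\<^sup>2 / 2)"
proof -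
  have "(\<integral>\<^sup>+x. ennreal x * indicator {0<..<A} x \<partial>lborel) = ennreal (A\<^sup>2 / 2 - 0\<^sup>2 / 2)"
    using A by (intro nn_integral_Ioo_FTC) (auto intro!: derivative_eq_intros)
  then show ?thesis by simp
qed

lemma nn_integral_Ioo_recip:
  "(\<integral>\<^sup>+x. ennreal (1 / (2 * (1 + x))) * indicator {0<..<A} x \<partial>lborel) = ennreal (surv_pre A)"
proof -
  have "(\<integral>\<^sup>+x. ennreal (1 / (2 * (1 + x))) * indicator {0<..<A} x \<partial>lborel) =
      ennreal (ln (1 + A) / 2 - ln (1 + 0) / 2)"
    using A by (intro nn_integral_Ioo_FTC) (auto intro!: derivative_eq_intros simp: divide_simps)
  then show ?thesis by (simp add: surv_pre_def)
qed

lemma DERIV_recip_shift: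
  "0 \<le> x \<Longrightarrow> ((\<lambda>x. 1 / (1 + x)) has_real_derivative - 1 / (1 + x)\<^sup>2) (at x)"
  by (auto intro!: derivative_eq_intros simp: power2_eq_square)

lemma nn_integral_Ioo_recip_square:
  "(\<integral>\<^sup>+x. ennreal (1 / (2 * (1 + x)\<^sup>2)) * indicator {0<..<A} x \<partial>lborel) = ennreal (A / (2 * (1 + A)))"
proof -
  have "(\<integral>\<^sup>+x. ennreal (1 / (2 * (1 + x)\<^sup>2)) * indicator {0<..<A} x \<partial>lborel) =
      ennreal (1 / (1 + A) * (- 1 / 2) - 1 / (1 + 0) * (- 1 / 2))"
  proof (rule nn_integral_Ioo_FTC)
    fix x :: real assume "0 \<le> x"
    from DERIV_mult[OF DERIV_recip_shift[OF this] DERIV_const[of "- 1 / 2"]]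
    show "((\<lambda>x. 1 / (1 + x) * (- 1 / 2)) has_real_derivative 1 / (2 * (1 + x)\<^sup>2)) (at x)"
      by (simp add: mult.commute)
  qed (use A in auto)
  also have "1 / (1 + A) * (- 1 / 2) - 1 / (1 + 0) * (- 1 / 2) = A / (2 * (1 + A))"
    using A by (simp add: divide_simps)
  finally show ?thesis .
qed

lemma nn_integral_Ioo_id_recip_square:
  "(\<integral>\<^sup>+x. ennreal (1 / (2 * (1 + x)\<^sup>2)) * ennreal x * indicator {0<..<A} x \<partial>lborel) = ennreal (surv_post A)"
proof -
  have "(\<integral>\<^sup>+x. ennreal (1 / (2 * (1 + x)\<^sup>2)) * ennreal x * indicator {0<..<A} x \<partial>lborel) =
      (\<integral>\<^sup>+x. ennreal (x / (2 * (1 + x)\<^sup>2)) * indicator {0<..<A} x \<partial>lborel)"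
    by (intro nn_integral_cong) (auto simp: indicator_def simp flip: ennreal_mult)
  also have "\<dots> = ennreal ((ln (1 + A) + 1 / (1 + A)) / 2 - (ln (1 + 0) + 1 / (1 + 0)) / 2)"
  proof (rule nn_integral_Ioo_FTC)
    fix x :: real assume x: "0 \<le> x"
    have "((\<lambda>x. ln (1 + x)) has_real_derivative 1 / (1 + x)) (at x)"
      using x by (auto intro!: derivative_eq_intros)
    from DERIV_cdivide[OF DERIV_add[OF this DERIV_recip_shift[OF x]], of 2]
    show "((\<lambda>x. (ln (1 + x) + 1 / (1 + x)) / 2) has_real_derivative x / (2 * (1 + x)\<^sup>2)) (at x)"
      by (rule DERIV_cong) (use x in \<open>simp add: divide_simps power2_eq_square\<close>)
  qed (use A in auto)
  also have "(ln (1 + A) + 1 / (1 + A)) / 2 - (ln (1 + 0) + 1 / (1 + 0)) / 2 = surv_post A"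
  proof -
    have "1 - 1 / (1 + A) = A / (1 + A)" using A by (simp add: divide_simps)
    moreover have "ln (1 + 0) = (0 :: real)" by simp
    ultimately show ?thesis unfolding surv_post_def by (simp only: add_0_right div_by_1) argo
  qed
  finally show ?thesis .
qed

lemma surv_pre_nonneg: "0 \<le> surv_pre A"
  using A by (simp add: surv_pre_def)

lemma surv_post_nonneg: "0 \<le> surv_post A"
proof -
  have "1 - 1 / (1 + A) \<le> ln (1 + A)"
    using ln_le_minus_one[of "1 / (1 + A)"] A by (simp add: ln_div)
  moreover have "1 - 1 / (1 + A) = A / (1 + A)" using A by (simp add: field_simps)
  ultimately show ?thesis by (simp add: surv_post_def)
qed

lemma surv_post_eq: "surv_post A = surv_pre A - A / (2 * (1 + A))"
  by (simp add: surv_post_def surv_pre_def diff_divide_distrib)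

lemma surv_post_le: "surv_post A \<le> surv_pre A"
  using A by (simp add: surv_post_eq)

lemma surv_pre_less_1: "A \<le> 2 \<Longrightarrow> surv_pre A < 1"
  using A ln_add_one_self_less_self[of A] by (cases "A = 0") (auto simp: surv_pre_def)

lemma surv_post_less_1: "A \<le> 2 \<Longrightarrow> surv_post A < 1"
  using surv_post_le surv_pre_less_1 by linarith

lemma sr_delay_nonneg: "A \<le> 2 \<Longrightarrow> 0 \<le> sr_delay A"
  using surv_post_less_1 A by (simp add: sr_delay_def)

end

text \<open>The probability \<open>s\<close> of reaching the changepoint cancels in the quotient.
  Both procedures satisfy these hypotheses at every \<nu>, which makes their conditional delays
  constant.\<close>

lemma cond_delay_geometric:
  assumes "\<And>n. {\<omega> \<in> space M. T \<omega> > enat n} \<in> sets M"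
    and "0 \<le> A" "A \<le> 2" "0 < s"
    and "emeasure M {\<omega> \<in> space M. T \<omega> > enat \<nu>} = ennreal s"
    and "\<And>j. emeasure M {\<omega> \<in> space M. T \<omega> > enat (\<nu> + Suc j)} =
      ennreal (s * (A\<^sup>2 / (4 * (1 + A))) * surv_post A ^ j)"
  shows "cond_delay M T \<nu> = ennreal (sr_delay A)"
proof -
  note q = surv_post_nonneg[OF assms(2)] surv_post_less_1[OF assms(2,3)]
  have "(\<Sum>n. emeasure M {\<omega> \<in> space M. T \<omega> > enat (\<nu> + n)}) =
      ennreal (s + s * (A\<^sup>2 / (4 * (1 + A))) / (1 - surv_post A))"
    using assms q by (intro suminf_ennreal_geometric_tail) auto
  also have "s + s * (A\<^sup>2 / (4 * (1 + A))) / (1 - surv_post A) = s * sr_delay A"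
    by (simp add: sr_delay_def distrib_left)
  finally show ?thesis
    unfolding cond_delay_def nn_integral_delay_eq_suminf[OF assms(1)] assms(5)
    using assms(4) sr_delay_nonneg[OF assms(2,3)] by (simp add: divide_ennreal)
qed

section \<open>Survival probabilities and delay of the SR-r procedure\<close>

context exponential_model
begin

lemma alive_in_P: "{\<omega> \<in> space (P \<nu>). T_sr L r A \<omega> > enat n} \<in> sets (P \<nu>)"
  using alive_in_obs[of n r A] sets_obs_subset[of n \<nu>]
  by (auto simp: space_P[of \<nu>] Int_def conj_commute)

lemma emeasure_alive:
  "emeasure (P \<nu>) {\<omega> \<in> space (P \<nu>). T_sr L r A \<omega> > enat n} = (\<integral>\<^sup>+\<omega>. indicator (alive r A n) \<omega> \<partial>P \<nu>)"
proof -
  have "(\<integral>\<^sup>+\<omega>. indicator (alive r A n) \<omega> \<partial>P \<nu>) =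
      (\<integral>\<^sup>+\<omega>. indicator {\<omega> \<in> space (P \<nu>). T_sr L r A \<omega> > enat n} \<omega> \<partial>P \<nu>)"
    by (intro nn_integral_cong) (simp add: indicator_def)
  then show ?thesis using alive_in_P by (simp add: nn_integral_indicator)
qed

lemma nn_integral_alive_0:
  assumes "\<And>\<omega>. h (SR_stat L r 0 \<omega>) = ennreal c"
  shows "(\<integral>\<^sup>+\<omega>. h (SR_stat L r 0 \<omega>) * indicator (alive r A 0) \<omega> \<partial>P \<nu>) = ennreal c"
proof -
  interpret prob_space "P \<nu>" by (rule prob)
  have "alive r A 0 = UNIV" by (simp add: T_sr_gt_iff)
  then show ?thesis using assms by (simp add: emeasure_space_1 del: SR_stat.simps)
qed

context
  fixes r A :: real
  assumes r: "0 \<le> r" and A: "0 < A" "A \<le> 2"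
begin

text \<open>The integrand is the very factor that \<open>nn_integral_alive_pre\<close> leaves at the
  preceding step. Feeding it back in closes the recursion, each step contributing the integral
  \<open>surv_pre A\<close>.\<close>

lemma nn_integral_alive_recip:
  "enat n \<le> \<nu> \<Longrightarrow> (\<integral>\<^sup>+\<omega>. ennreal (1 / (2 * (1 + SR_stat L r n \<omega>))) * indicator (alive r A n) \<omega> \<partial>P \<nu>) =
    ennreal (surv_pre A ^ n / (2 * (1 + r)))"
proof (induction n)
  case 0
  show ?case
    using nn_integral_alive_0[of "\<lambda>x. ennreal (1 / (2 * (1 + x)))" r] by simp
next
  case (Suc n)
  have "enat n \<le> \<nu>" using Suc.prems by (meson Suc_ile_eq order_less_imp_le)
  from Suc.IH[OF this] show ?case
    using nn_integral_alive_pre[of "\<lambda>x. ennreal (1 / (2 * (1 + x)))" n \<nu> r A] Suc.prems r A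
      surv_pre_nonneg[of A]
    by (simp add: nn_integral_Ioo_recip flip: ennreal_mult del: SR_stat.simps distrib_left_numeral)
qed

lemma nn_integral_alive_before:
  fixes h :: "real \<Rightarrow> ennreal"
  assumes "h \<in> borel_measurable borel" "enat (Suc n) \<le> \<nu>"
  shows "(\<integral>\<^sup>+\<omega>. h (SR_stat L r (Suc n) \<omega>) * indicator (alive r A (Suc n)) \<omega> \<partial>P \<nu>) =
    (\<integral>\<^sup>+x. h x * indicator {0<..<A} x \<partial>lborel) * ennreal (surv_pre A ^ n / (2 * (1 + r)))"
proof -
  have "enat n \<le> \<nu>" using assms(2) by (meson Suc_ile_eq order_less_imp_le)
  then show ?thesis
    using nn_integral_alive_pre[OF assms r A(2)] by (simp only: nn_integral_alive_recip)
qed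

lemma emeasure_alive_before:
  assumes "enat (Suc n) \<le> \<nu>"
  shows "emeasure (P \<nu>) {\<omega> \<in> space (P \<nu>). T_sr L r A \<omega> > enat (Suc n)} =
    ennreal (A * surv_pre A ^ n / (2 * (1 + r)))"
  using nn_integral_alive_before[of "\<lambda>_. ennreal 1", OF _ assms] nn_integral_Ioo_const[of A 1] A r
    surv_pre_nonneg[of A]
  by (simp add: emeasure_alive flip: ennreal_mult)

lemma emeasure_alive_0: "emeasure (P \<nu>) {\<omega> \<in> space (P \<nu>). T_sr L r A \<omega> > enat 0} = 1"
  unfolding emeasure_alive using nn_integral_alive_0[of "\<lambda>_. ennreal 1" r 1] by simp

text \<open>After the change the factor left behind is 1 / (2 (1 + x)^2); integrated against the
  density x it reproduces itself with ratio \<open>surv_post A\<close>.\<close>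

lemma nn_integral_alive_recip_square_step:
  "(\<integral>\<^sup>+\<omega>. ennreal (1 / (2 * (1 + SR_stat L r (m + j) \<omega>)\<^sup>2)) * indicator (alive r A (m + j)) \<omega> \<partial>P (enat m)) =
    ennreal (surv_post A ^ j) *
    (\<integral>\<^sup>+\<omega>. ennreal (1 / (2 * (1 + SR_stat L r m \<omega>)\<^sup>2)) * indicator (alive r A m) \<omega> \<partial>P (enat m))"
proof (induction j)
  case (Suc j)
  have "(\<integral>\<^sup>+\<omega>. ennreal (1 / (2 * (1 + SR_stat L r (m + Suc j) \<omega>)\<^sup>2)) * indicator (alive r A (m + Suc j)) \<omega> \<partial>P (enat m)) =
      ennreal (surv_post A) * (\<integral>\<^sup>+\<omega>. ennreal (1 / (2 * (1 + SR_stat L r (m + j) \<omega>)\<^sup>2)) * indicator (alive r A (m + j)) \<omega> \<partial>P (enat m))"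
    using nn_integral_alive_post[of "\<lambda>x. ennreal (1 / (2 * (1 + x)\<^sup>2))" "m + j" "enat m" r A] r A
    by (simp add: nn_integral_Ioo_id_recip_square del: SR_stat.simps)
  then show ?case
    using surv_post_nonneg[of A] A by (simp only: Suc.IH) (simp add: ennreal_mult mult.assoc)
qed simp

lemma emeasure_alive_after:
  "emeasure (P (enat m)) {\<omega> \<in> space (P (enat m)). T_sr L r A \<omega> > enat (m + Suc j)} =
    ennreal (A\<^sup>2 / 2 * surv_post A ^ j) *
    (\<integral>\<^sup>+\<omega>. ennreal (1 / (2 * (1 + SR_stat L r m \<omega>)\<^sup>2)) * indicator (alive r A m) \<omega> \<partial>P (enat m))"
proof -
  have "ennreal (A\<^sup>2 / 2 * surv_post A ^ j) = ennreal (A\<^sup>2 / 2) * ennreal (surv_post A ^ j)"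
    by (rule ennreal_mult) (use A surv_post_nonneg[of A] in simp_all)
  then show ?thesis
    using nn_integral_alive_post[of "\<lambda>_. 1" "m + j" "enat m" r A] r A
    by (simp add: emeasure_alive nn_integral_Ioo_id nn_integral_alive_recip_square_step mult.assoc
        del: SR_stat.simps)
qed

lemma emeasure_alive_after_0:
  "emeasure (P (enat 0)) {\<omega> \<in> space (P (enat 0)). T_sr L r A \<omega> > enat (Suc j)} =
    ennreal (A\<^sup>2 / (4 * (1 + r)\<^sup>2) * surv_post A ^ j)"
  using emeasure_alive_after[of 0 j] nn_integral_alive_0[of "\<lambda>x. ennreal (1 / (2 * (1 + x)\<^sup>2))" r] r
    surv_post_nonneg[of A] A
  by (simp add: mult_ac flip: ennreal_mult)

text \<open>After at least one survived pre-change step the statistic is uniform on (0, A) given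
  survival, so the start matters only through the mass
  \<open>A * surv_pre A ^ n / (2 * (1 + r))\<close>.\<close>

lemma emeasure_alive_after_Suc:
  "emeasure (P (enat (Suc n))) {\<omega> \<in> space (P (enat (Suc n))). T_sr L r A \<omega> > enat (Suc n + Suc j)} =
    ennreal (A * surv_pre A ^ n / (2 * (1 + r)) * (A\<^sup>2 / (4 * (1 + A))) * surv_post A ^ j)"
proof -
  have eq: "A\<^sup>2 / 2 * surv_post A ^ j * (A / (2 * (1 + A)) * (surv_pre A ^ n / (2 * (1 + r)))) =
      A * surv_pre A ^ n / (2 * (1 + r)) * (A\<^sup>2 / (4 * (1 + A))) * surv_post A ^ j"
    by (simp add: algebra_simps)
  show ?thesis
    unfolding emeasure_alive_after eq[symmetric]
    using nn_integral_alive_before[of "\<lambda>x. ennreal (1 / (2 * (1 + x)\<^sup>2))" n "enat (Suc n)"]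
      nn_integral_Ioo_recip_square[of A] r A surv_post_nonneg[of A] surv_pre_nonneg[of A]
    by (simp flip: ennreal_mult del: SR_stat.simps)
qed

lemma mean_time_T_sr:
  "mean_time (P \<infinity>) (T_sr L r A) = ennreal (1 + A / (2 * (1 + r)) / (1 - surv_pre A))"
  unfolding mean_time_eq_suminf[OF alive_in_P]
proof (rule suminf_ennreal_geometric_tail)
  show "emeasure (P \<infinity>) {\<omega> \<in> space (P \<infinity>). T_sr L r A \<omega> > enat (Suc j)} =
      ennreal (A / (2 * (1 + r)) * surv_pre A ^ j)" for j
    using emeasure_alive_before[of j \<infinity>] by simp
qed (use r A emeasure_alive_0[of \<infinity>] surv_pre_nonneg surv_pre_less_1 in auto)

end

text \<open>The start solves (1 + r)^2 = 1 + A. This gives \<nu> = 0 the same first-step survival as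
  all later changepoints, so the supremum runs over a constant.\<close>

lemma pollak_delay_T_sr:
  assumes A: "0 < A" "A \<le> 2"
  shows "pollak_delay P (T_sr L (sqrt (1 + A) - 1) A) = ennreal (sr_delay A)"
proof -
  define r where "r = sqrt (1 + A) - 1"
  have r: "0 \<le> r" "(1 + r)\<^sup>2 = 1 + A" using A by (auto simp: r_def)
  have p: "0 < surv_pre A" using A by (simp add: surv_pre_def)
  have cd: "cond_delay (P (enat \<nu>)) (T_sr L r A) \<nu> = ennreal (sr_delay A)" for \<nu>
  proof (cases \<nu>)
    case 0
    show ?thesis
      unfolding 0
      by (rule cond_delay_geometric[where s = 1])
         (use A r alive_in_P emeasure_alive_0[OF r(1) A] emeasure_alive_after_0[OF r(1) A] in simp_all)
  next
    case (Suc n)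
    show ?thesis
      unfolding Suc
      by (rule cond_delay_geometric[where s = "A * surv_pre A ^ n / (2 * (1 + r))"])
         (use A r p alive_in_P emeasure_alive_before[OF r(1) A] emeasure_alive_after_Suc[OF r(1) A] in simp_all)
  qed
  have "emeasure (P (enat 0)) {\<omega> \<in> space (P (enat 0)). T_sr L r A \<omega> > enat 0} > 0"
    using emeasure_alive_0[OF r(1) A, of "enat 0"] by simp
  then have "{\<nu>::nat. emeasure (P (enat \<nu>)) {\<omega> \<in> space (P (enat \<nu>)). T_sr L r A \<omega> > enat \<nu>} > 0} \<noteq> {}"
    by blast
  then show ?thesis
    unfolding pollak_delay_def r_def[symmetric] cd by (rule SUP_const)
qed

end

section \<open>The lower bound\<close>

text \<open>The unconditional form holds for every \<nu>: a changepoint with a null conditioning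
  event is absent from the supremum, but then both sides vanish.\<close>

lemma suminf_enat_tail_le_pollak_delay:
  fixes P :: "enat \<Rightarrow> 'a measure"
  assumes fin: "finite_measure (P (enat \<nu>))"
    and meas: "\<And>n. {\<omega> \<in> space (P (enat \<nu>)). T \<omega> > enat n} \<in> sets (P (enat \<nu>))"
  shows "(\<Sum>n. emeasure (P (enat \<nu>)) {\<omega> \<in> space (P (enat \<nu>)). T \<omega> > enat (\<nu> + n)}) \<le>
    pollak_delay P T * emeasure (P (enat \<nu>)) {\<omega> \<in> space (P (enat \<nu>)). T \<omega> > enat \<nu>}"
proof -
  let ?D = "\<lambda>n. {\<omega> \<in> space (P (enat \<nu>)). T \<omega> > enat n}"
  show ?thesis
  proof (cases "emeasure (P (enat \<nu>)) (?D \<nu>) = 0")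
    case True
    have "emeasure (P (enat \<nu>)) (?D (\<nu> + n)) = 0" for n
    proof -
      have "?D (\<nu> + n) \<subseteq> ?D \<nu>" by (auto intro: le_less_trans[rotated])
      then have "emeasure (P (enat \<nu>)) (?D (\<nu> + n)) \<le> emeasure (P (enat \<nu>)) (?D \<nu>)"
        by (intro emeasure_mono meas)
      then show ?thesis using True by simp
    qed
    then show ?thesis by simp
  next
    case False
    then have "cond_delay (P (enat \<nu>)) T \<nu> \<le> pollak_delay P T"
      unfolding pollak_delay_def by (intro SUP_upper) (simp add: zero_less_iff_neq_zero)
    then have "(\<Sum>n. emeasure (P (enat \<nu>)) (?D (\<nu> + n))) / emeasure (P (enat \<nu>)) (?D \<nu>) \<le> pollak_delay P T"
      unfolding cond_delay_def nn_integral_delay_eq_suminf[OF meas] .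
    then have "(\<Sum>n. emeasure (P (enat \<nu>)) (?D (\<nu> + n))) / emeasure (P (enat \<nu>)) (?D \<nu>) *
        emeasure (P (enat \<nu>)) (?D \<nu>) \<le> pollak_delay P T * emeasure (P (enat \<nu>)) (?D \<nu>)"
      by (rule mult_right_mono) simp
    then show ?thesis
      using False finite_measure.emeasure_finite[OF fin, of "?D \<nu>"]
      by (simp add: ennreal_divide_times ennreal_divide_self less_top)
  qed
qed

text \<open>For given \<open>\<lambda>\<close>, minimise the sum over \<open>n\<close> of \<open>E\<^sub>\<infinity> [(1 + R\<^sub>n - \<lambda>) 1 {T > n}]\<close> over stopping times
  \<open>T\<close>.  For \<open>\<lambda> = A + 2 - d\<close>, with \<open>d = sr_delay A\<close>, it is optimal to stop as soon as \<open>R\<^sub>n\<close>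
  exceeds \<open>A\<close>, and the value when starting from \<open>z\<close> is the negative of \<open>sr_gain A z\<close>.\<close>

definition sr_gain_mean :: "real \<Rightarrow> real" where
  "sr_gain_mean A = A\<^sup>2 / (2 * (1 - surv_post A))"

text \<open>The value for which the expression inside the maximum in \<open>sr_gain A z\<close>
  vanishes exactly at z = A.\<close>

definition sr_multiplier :: "real \<Rightarrow> real" where
  "sr_multiplier A = A + 2 - sr_delay A"

text \<open>Bellman form: stop with gain 0, or collect \<open>sr_multiplier A - 1 - z\<close> and
  continue. The last term is the expected gain after one more observation, because
  \<open>sr_gain_mean A\<close> is the integral of the gain over (0, A), as
  \<open>nn_integral_sr_gain\<close> confirms.\<close>

definition sr_gain :: "real \<Rightarrow> real \<Rightarrow> real" where
  "sr_gain A z = max 0 (sr_multiplier A - 1 - z + sr_gain_mean A / (2 * (1 + z)))"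

lemma measurable_sr_gain [measurable]: "sr_gain A \<in> borel_measurable borel"
  unfolding sr_gain_def[abs_def] by measurable

lemma sr_gain_nonneg: "0 \<le> sr_gain A z"
  by (simp add: sr_gain_def)

context
  fixes A :: real
  assumes A: "0 < A" "A \<le> 2"
begin

text \<open>The closed forms cleared of denominators, so that the later identities become polynomial
  algebra.\<close>

private lemma gain_facts:
  "sr_gain_mean A * (1 - surv_post A) = A\<^sup>2 / 2"
  "(sr_delay A - 1) * (2 * (1 + A)) = sr_gain_mean A"
  "(surv_pre A - surv_post A) * (2 * (1 + A)) = A"
  "0 \<le> sr_gain_mean A"
  "surv_post A < 1" "surv_pre A < 1"
proof -
  show q: "surv_post A < 1" "surv_pre A < 1"
    using surv_post_less_1[of A] surv_pre_less_1[of A] A by auto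
  show "sr_gain_mean A * (1 - surv_post A) = A\<^sup>2 / 2" "0 \<le> sr_gain_mean A"
    using q by (auto simp: sr_gain_mean_def field_simps)
  have "(1 + A) \<noteq> 0" "1 - surv_post A \<noteq> 0" using A q by auto
  then show "(sr_delay A - 1) * (2 * (1 + A)) = sr_gain_mean A"
    by (simp add: sr_delay_def sr_gain_mean_def divide_simps) (simp add: algebra_simps)
  show "(surv_pre A - surv_post A) * (2 * (1 + A)) = A"
    using A by (simp add: surv_post_eq)
qed

private lemma delay_eq: "sr_delay A - 1 = sr_gain_mean A / (2 * (1 + A))"
  using gain_facts(2) A by (simp add: eq_divide_eq)

text \<open>Equivalent to \<open>sr_delay A - 1 \<le> A / 2\<close>, which follows from
  \<open>surv_pre A < 1\<close>. It makes the denominator \<open>l - j\<close> positive in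
  \<open>pollak_delay_lower_bound\<close>.\<close>

lemma sr_delay_le_multiplier: "sr_delay A \<le> sr_multiplier A"
proof -
  have "0 \<le> (1 - surv_pre A) * (2 * (1 + A))" using gain_facts(6) A by simp
  then have "A \<le> (1 - surv_post A) * (2 * (1 + A))"
    using gain_facts(3) by (simp add: algebra_simps)
  moreover have "0 \<le> sr_delay A - 1" using delay_eq gain_facts(4) A by simp
  ultimately have "(sr_delay A - 1) * A \<le> (sr_delay A - 1) * ((1 - surv_post A) * (2 * (1 + A)))"
    by (rule mult_left_mono)
  also have "\<dots> = sr_gain_mean A * (1 - surv_post A)" unfolding gain_facts(2)[symmetric] by simp
  also have "\<dots> = A / 2 * A" unfolding gain_facts(1) by (simp add: power2_eq_square)
  finally have "sr_delay A - 1 \<le> A / 2" using A by (simp only: mult_le_cancel_right)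
  then show ?thesis by (simp add: sr_multiplier_def)
qed

text \<open>The expression inside the maximum decreases in z and is zero at A, so it is nonnegative
  up to A and nonpositive beyond.\<close>

lemma sr_gain_below:
  assumes "0 \<le> z" "z \<le> A"
  shows "sr_gain A z = sr_multiplier A - 1 - z + sr_gain_mean A / (2 * (1 + z))"
proof -
  have "sr_gain_mean A / (2 * (1 + A)) \<le> sr_gain_mean A / (2 * (1 + z))"
    using assms gain_facts(4) by (intro divide_left_mono) auto
  then show ?thesis
    using assms delay_eq by (simp add: sr_gain_def sr_multiplier_def)
qed

lemma sr_gain_above:
  assumes "A \<le> z"
  shows "sr_gain A z = 0"
proof -
  have "sr_gain_mean A / (2 * (1 + z)) \<le> sr_gain_mean A / (2 * (1 + A))"
    using assms A gain_facts(4) by (intro divide_left_mono) auto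
  then show ?thesis
    using assms delay_eq by (simp add: sr_gain_def sr_multiplier_def)
qed

text \<open>With K, d, p, q for gain mean, delay and the two ratios, integration gives A^2 / 2 - (d
  - 1) A + K p. As (d - 1) A = K (p - q), this equals K precisely when K (1 - q) = A^2 / 2, the
  equation that defines K.\<close>

lemma nn_integral_sr_gain: "(\<integral>\<^sup>+x. ennreal (sr_gain A x) * indicator {0<..<A} x \<partial>lborel) = ennreal (sr_gain_mean A)"
proof -
  let ?l = "sr_multiplier A" and ?K = "sr_gain_mean A"
  let ?F = "\<lambda>x. (?l - 1) * x - x\<^sup>2 / 2 + ?K * (ln (1 + x) / 2)"
  have "(\<integral>\<^sup>+x. ennreal (sr_gain A x) * indicator {0<..<A} x \<partial>lborel) = ennreal (?F A - ?F 0)"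
  proof (rule nn_integral_Ioo_FTC)
    fix x assume x: "0 \<le> x" "x \<le> A"
    have "((\<lambda>x. ln (1 + x)) has_real_derivative 1 / (1 + x)) (at x)"
      using x by (auto intro!: derivative_eq_intros)
    then have "(?F has_real_derivative (?l - 1) * 1 - 2 * x / 2 + ?K * (1 / (1 + x) / 2)) (at x)"
      by (intro DERIV_add DERIV_diff DERIV_cmult DERIV_cdivide DERIV_ident) (auto intro!: derivative_eq_intros)
    then show "(?F has_real_derivative sr_gain A x) (at x)"
      by (rule DERIV_cong) (use x in \<open>simp add: sr_gain_below\<close>)
  qed (use A sr_gain_nonneg in auto)
  also have "?F A - ?F 0 = ?K"
  proof -
    have "(sr_delay A - 1) * A = (sr_delay A - 1) * ((surv_pre A - surv_post A) * (2 * (1 + A)))"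
      using gain_facts(3) by simp
    also have "\<dots> = ?K * (surv_pre A - surv_post A)" unfolding gain_facts(2)[symmetric] by simp
    finally have "(sr_delay A - 1) * A = ?K * (surv_pre A - surv_post A)" .
    moreover have "?F A - ?F 0 = A\<^sup>2 / 2 - (sr_delay A - 1) * A + ?K * surv_pre A"
      by (simp add: sr_multiplier_def surv_pre_def power2_eq_square algebra_simps)
    ultimately show ?thesis
      using gain_facts(1) by (simp add: algebra_simps)
  qed
  finally show ?thesis .
qed

text \<open>The gain vanishes from A on, so the truncation in \<open>nn_integral_step_pre\<close>
  costs nothing.\<close>

lemma nn_integral_sr_gain_step:
  assumes "0 \<le> y"
  shows "(\<integral>\<^sup>+x. ennreal (sr_gain A ((1 + y) * lr x)) * ennreal (pre_density x) \<partial>lborel) =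
    ennreal (sr_gain_mean A / (2 * (1 + y)))"
proof -
  have "(\<integral>\<^sup>+x. ennreal (sr_gain A ((1 + y) * lr x)) * ennreal (pre_density x) \<partial>lborel) =
      (\<integral>\<^sup>+x. ennreal (sr_gain A ((1 + y) * lr x)) * indicator {..<A} ((1 + y) * lr x) * ennreal (pre_density x) \<partial>lborel)"
    by (intro nn_integral_cong) (simp add: indicator_def sr_gain_above)
  also have "\<dots> = ennreal (1 / (2 * (1 + y))) * ennreal (sr_gain_mean A)"
    using nn_integral_step_pre[of "\<lambda>x. ennreal (sr_gain A x)" y A] assms A
    by (simp only: nn_integral_sr_gain) simp
  finally show ?thesis
    using assms gain_facts(4) by (simp flip: ennreal_mult)
qed

text \<open>Here \<open>g\<close> is the no-change mean of the SR-r procedure with 1 + r =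
  \<open>s\<close>. The identity is the case of equality in the lower bound, attained by that
  procedure.\<close>

lemma sr_gain_start:
  defines "s \<equiv> sqrt (1 + A)"
  defines "g \<equiv> 1 + A / (2 * s) / (1 - surv_pre A)"
  shows "sr_delay A * (s - 1 + g) = sr_multiplier A * g - sr_gain A (s - 1)"
proof -
  define D where "D = sr_delay A - 1"
  have s: "s\<^sup>2 = 1 + A" "1 \<le> s" using A by (auto simp: s_def)
  have "s * 1 \<le> s * s" using s(2) by (intro mult_left_mono) auto
  then have "s \<le> s\<^sup>2" by (simp only: power2_eq_square mult_1_right)
  then have "s - 1 \<le> A" using s by simp
  then have "sr_gain A (s - 1) = A + 1 - sr_delay A - (s - 1) + sr_gain_mean A / (2 * s)"
    using s by (simp add: sr_gain_below sr_multiplier_def)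
  also have "sr_gain_mean A / (2 * s) = D * s"
    unfolding gain_facts(2)[symmetric] D_def s(1)[symmetric] using s(2) by (simp add: power2_eq_square)
  finally have gain: "sr_gain A (s - 1) = A - D - (s - 1) + D * s" by (simp add: D_def)
  have sq: "A\<^sup>2 = 2 * sr_gain_mean A * (1 - surv_post A)" using gain_facts(1) by simp
  \<comment> \<open>With the gain inserted, the claim reduces to
    \<open>(g - 1) * (A - 2 * D) = 2 * D * s\<close>. It is derived after multiplication by
    \<open>2 * s * (1 - surv_pre A)\<close>, which turns \<open>g - 1\<close> into
    \<open>A\<close>.\<close>
  have "A * (A - 2 * D) = A\<^sup>2 - 2 * (D * A)" by (simp add: power2_eq_square algebra_simps)
  also have "D * A = D * ((surv_pre A - surv_post A) * (2 * (1 + A)))" using gain_facts(3) by simp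
  also have "\<dots> = sr_gain_mean A * (surv_pre A - surv_post A)"
    unfolding gain_facts(2)[symmetric] D_def by simp
  also have "A\<^sup>2 - 2 * \<dots> = 2 * sr_gain_mean A * (1 - surv_pre A)"
    unfolding sq by (simp add: algebra_simps)
  also have "\<dots> = 2 * s * (1 - surv_pre A) * (2 * D * s)"
    unfolding gain_facts(2)[symmetric] D_def s(1)[symmetric] by (simp add: power2_eq_square)
  finally have "A * (A - 2 * D) = 2 * s * (1 - surv_pre A) * (2 * D * s)" .
  moreover have "A = 2 * s * (1 - surv_pre A) * (g - 1)"
    using s gain_facts(6) by (simp add: g_def)
  ultimately have "2 * s * (1 - surv_pre A) * ((g - 1) * (A - 2 * D)) = 2 * s * (1 - surv_pre A) * (2 * D * s)"
    by (metis mult.assoc)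
  then have "(g - 1) * (A - 2 * D) = 2 * D * s"
    using s gain_facts(6) by simp
  moreover have eqs: "sr_delay A = 1 + D" "sr_multiplier A = A + 1 - D" by (simp_all add: D_def sr_multiplier_def)
  ultimately show ?thesis unfolding gain eqs by (simp add: algebra_simps)
qed

end

section \<open>Bellman inequality and change of measure for an arbitrary stopping time\<close>

context exponential_model
begin

context
  fixes A r :: real and T :: "'a \<Rightarrow> enat"
  assumes A: "0 < A" "A \<le> 2" and r: "0 \<le> r"
    and T: "stopping_time (obs_filtration (space (P \<infinity>)) X) T"
begin

private abbreviation D :: "nat \<Rightarrow> 'a set" where
  "D n \<equiv> {\<omega> \<in> space (P \<infinity>). T \<omega> > enat n}"

lemma stopping_time_in_obs: "D n \<in> sets (obs n)"
proof -
  have "{\<omega> \<in> space (obs n). T \<omega> \<le> enat n} \<in> sets (obs n)"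
    using T unfolding stopping_time_def pred_def by blast
  from sets.compl_sets[OF this] show ?thesis
    by (rule back_subst[where P = "\<lambda>S. S \<in> sets (obs n)"]) auto
qed

lemma stopping_time_in_P: "D n \<in> sets (P \<nu>)"
  using stopping_time_in_obs sets_obs_subset by blast

lemma measurable_stopping_time: "n \<le> m \<Longrightarrow> (indicator (D n) :: 'a \<Rightarrow> ennreal) \<in> borel_measurable (obs m)"
  using measurable_obs_mono[OF borel_measurable_indicator[OF stopping_time_in_obs]] by blast

text \<open>The maximum in \<open>sr_gain\<close> dominates its continuation branch, and
  \<open>nn_integral_sr_gain_step\<close> identifies the fraction there with the expected gain after
  the next observation. All terms are placed so that nothing is subtracted in
  \<open>ennreal\<close>.\<close>

lemma bellman_step:
  "ennreal (sr_multiplier A) * emeasure (P \<infinity>) (D n) +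
    (\<integral>\<^sup>+\<omega>. ennreal (sr_gain A (SR_stat L r (Suc n) \<omega>)) * indicator (D (Suc n)) \<omega> \<partial>P \<infinity>)
   \<le> (\<integral>\<^sup>+\<omega>. ennreal (1 + SR_stat L r n \<omega>) * indicator (D n) \<omega> \<partial>P \<infinity>) +
    (\<integral>\<^sup>+\<omega>. ennreal (sr_gain A (SR_stat L r n \<omega>)) * indicator (D n) \<omega> \<partial>P \<infinity>)"
proof -
  note [measurable] = measurable_obs[OF measurable_SR[of r n], of \<infinity>]
    measurable_obs[OF measurable_stopping_time[OF order_refl, of n], of \<infinity>]
  let ?R = "SR_stat L r n"
  have mult: "0 \<le> sr_multiplier A"
    using sr_delay_le_multiplier[OF A] sr_delay_nonneg[of A] A by simp
  have "(\<integral>\<^sup>+\<omega>. ennreal (sr_gain A (SR_stat L r (Suc n) \<omega>)) * indicator (D (Suc n)) \<omega> \<partial>P \<infinity>) \<le>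
      (\<integral>\<^sup>+\<omega>. ennreal (sr_gain A ((1 + ?R \<omega>) * lr (X (Suc n) \<omega>))) * indicator (D n) \<omega> \<partial>P \<infinity>)"
  proof (rule nn_integral_mono)
    fix \<omega> assume "\<omega> \<in> space (P \<infinity>)"
    have "T \<omega> > enat n" if "T \<omega> > enat (Suc n)"
      using that by (meson enat_ord_simps(2) lessI less_trans)
    then show "ennreal (sr_gain A (SR_stat L r (Suc n) \<omega>)) * indicator (D (Suc n)) \<omega> \<le>
        ennreal (sr_gain A ((1 + ?R \<omega>) * lr (X (Suc n) \<omega>))) * indicator (D n) \<omega>"
      by (simp add: L_eq indicator_def)
  qed
  also have "\<dots> = (\<integral>\<^sup>+\<omega>. (\<integral>\<^sup>+x. ennreal (sr_gain A ((1 + ?R \<omega>) * lr x)) * indicator (D n) \<omega> *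
      ennreal (pre_density x) \<partial>lborel) \<partial>P \<infinity>)"
  proof -
    note [measurable] = measurable_SR[of r n]
    have "(\<lambda>(\<omega>, x). ennreal (sr_gain A ((1 + ?R \<omega>) * lr x)) * indicator (D n) \<omega>) \<in> borel_measurable (obs n \<Otimes>\<^sub>M borel)"
      unfolding case_prod_beta
      by (intro borel_measurable_times_ennreal measurable_compose[OF measurable_fst measurable_stopping_time[OF order_refl]])
         measurable
    from nn_integral_next[OF this, of \<infinity>] show ?thesis by simp
  qed
  also have "\<dots> = (\<integral>\<^sup>+\<omega>. ennreal (sr_gain_mean A / (2 * (1 + ?R \<omega>))) * indicator (D n) \<omega> \<partial>P \<infinity>)"
    using nn_integral_sr_gain_step[OF A SR_nonneg[OF r, of n]]
    by (intro nn_integral_cong) (simp add: indicator_def)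
  finally have "ennreal (sr_multiplier A) * emeasure (P \<infinity>) (D n) +
      (\<integral>\<^sup>+\<omega>. ennreal (sr_gain A (SR_stat L r (Suc n) \<omega>)) * indicator (D (Suc n)) \<omega> \<partial>P \<infinity>) \<le>
      (\<integral>\<^sup>+\<omega>. ennreal (sr_multiplier A) * indicator (D n) \<omega> \<partial>P \<infinity>) +
      (\<integral>\<^sup>+\<omega>. ennreal (sr_gain_mean A / (2 * (1 + ?R \<omega>))) * indicator (D n) \<omega> \<partial>P \<infinity>)"
    using stopping_time_in_P by (simp add: nn_integral_cmult_indicator)
  also have "\<dots> = (\<integral>\<^sup>+\<omega>. ennreal (sr_multiplier A) * indicator (D n) \<omega> +
      ennreal (sr_gain_mean A / (2 * (1 + ?R \<omega>))) * indicator (D n) \<omega> \<partial>P \<infinity>)"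
    by (intro nn_integral_add[symmetric] borel_measurable_times_ennreal
        measurable_obs[OF measurable_stopping_time[OF order_refl]]) measurable
  also have "\<dots> \<le> (\<integral>\<^sup>+\<omega>. ennreal (1 + ?R \<omega>) * indicator (D n) \<omega> +
      ennreal (sr_gain A (?R \<omega>)) * indicator (D n) \<omega> \<partial>P \<infinity>)"
  proof (rule nn_integral_mono)
    fix \<omega>
    have "0 \<le> ?R \<omega>" by (rule SR_nonneg[OF r])
    moreover have "0 \<le> sr_gain_mean A"
      using surv_post_less_1[of A] A by (simp add: sr_gain_mean_def)
    moreover have "sr_multiplier A + sr_gain_mean A / (2 * (1 + ?R \<omega>)) \<le> 1 + ?R \<omega> + sr_gain A (?R \<omega>)"
      by (simp add: sr_gain_def)
    ultimately have "ennreal (sr_multiplier A) + ennreal (sr_gain_mean A / (2 * (1 + ?R \<omega>))) \<le>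
        ennreal (1 + ?R \<omega>) + ennreal (sr_gain A (?R \<omega>))"
      using mult sr_gain_nonneg by (simp flip: ennreal_plus del: distrib_left_numeral)
    then show "ennreal (sr_multiplier A) * indicator (D n) \<omega> +
        ennreal (sr_gain_mean A / (2 * (1 + ?R \<omega>))) * indicator (D n) \<omega> \<le>
        ennreal (1 + ?R \<omega>) * indicator (D n) \<omega> + ennreal (sr_gain A (?R \<omega>)) * indicator (D n) \<omega>"
      by (simp only: distrib_right[symmetric] mult_right_mono zero_le)
  qed
  also have "\<dots> = (\<integral>\<^sup>+\<omega>. ennreal (1 + ?R \<omega>) * indicator (D n) \<omega> \<partial>P \<infinity>) +
      (\<integral>\<^sup>+\<omega>. ennreal (sr_gain A (?R \<omega>)) * indicator (D n) \<omega> \<partial>P \<infinity>)"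
    by (intro nn_integral_add borel_measurable_times_ennreal
        measurable_obs[OF measurable_stopping_time[OF order_refl]]) measurable
  finally show ?thesis .
qed

text \<open>\<open>bellman_step\<close> telescopes; the nonnegative gain remaining at time
  \<open>N\<close> is dropped.\<close>

lemma bellman_sum:
  "ennreal (sr_multiplier A) * (\<Sum>n<N. emeasure (P \<infinity>) (D n)) \<le>
    (\<Sum>n<N. \<integral>\<^sup>+\<omega>. ennreal (1 + SR_stat L r n \<omega>) * indicator (D n) \<omega> \<partial>P \<infinity>) + ennreal (sr_gain A r)"
proof -
  interpret prob_space "P \<infinity>" by (rule prob)
  let ?c = "\<lambda>n. \<integral>\<^sup>+\<omega>. ennreal (sr_gain A (SR_stat L r n \<omega>)) * indicator (D n) \<omega> \<partial>P \<infinity>"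
  let ?e = "\<lambda>n. \<integral>\<^sup>+\<omega>. ennreal (1 + SR_stat L r n \<omega>) * indicator (D n) \<omega> \<partial>P \<infinity>"
  let ?a = "\<lambda>n. emeasure (P \<infinity>) (D n)" and ?l = "ennreal (sr_multiplier A)"
  have "?l * (\<Sum>n<N. ?a n) + ?c N \<le> (\<Sum>n<N. ?e n) + ?c 0"
  proof (induction N)
    case (Suc N)
    have "?l * (\<Sum>n<Suc N. ?a n) + ?c (Suc N) = ?l * (\<Sum>n<N. ?a n) + (?l * ?a N + ?c (Suc N))"
      by (simp only: sum.lessThan_Suc distrib_left add.assoc)
    also have "\<dots> \<le> ?l * (\<Sum>n<N. ?a n) + (?e N + ?c N)"
      by (rule add_left_mono[OF bellman_step])
    also have "\<dots> = (?l * (\<Sum>n<N. ?a n) + ?c N) + ?e N" by (simp only: ac_simps)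
    also have "\<dots> \<le> ((\<Sum>n<N. ?e n) + ?c 0) + ?e N" by (rule add_right_mono[OF Suc.IH])
    also have "\<dots> = (\<Sum>n<Suc N. ?e n) + ?c 0" by (simp only: sum.lessThan_Suc ac_simps)
    finally show ?case .
  qed simp
  moreover have "?c 0 \<le> ennreal (sr_gain A r)"
  proof -
    have "?c 0 \<le> (\<integral>\<^sup>+\<omega>. ennreal (sr_gain A r) \<partial>P \<infinity>)"
      by (intro nn_integral_mono) (simp add: indicator_def)
    then show ?thesis by (simp add: emeasure_space_1)
  qed
  ultimately show ?thesis
    by (meson add_left_mono order_trans le_add_same_cancel1 zero_le add_increasing2 order_refl)
qed

text \<open>\<open>nn_integral_SR\<close> turns each summand into probabilities of T > n over all
  changepoints k \<le> n, with extra weight \<open>r\<close> at 0. Summing over n first yields, for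
  each k, a truncated expected delay, bounded through \<open>pollak_delay P T\<close>.\<close>

lemma sum_SR_le_pollak_delay:
  "(\<Sum>n<N. \<integral>\<^sup>+\<omega>. ennreal (1 + SR_stat L r n \<omega>) * indicator (D n) \<omega> \<partial>P \<infinity>) \<le>
    pollak_delay P T * (ennreal r + (\<Sum>n<N. emeasure (P \<infinity>) (D n)))"
proof -
  let ?J = "pollak_delay P T"
  have D_eq: "D n = {\<omega> \<in> space (P \<nu>). T \<omega> > enat n}" for n \<nu> by (simp add: space_P[of \<nu>])
  have tail: "(\<Sum>n\<in>{k..<N}. emeasure (P (enat k)) (D n)) \<le> ?J * emeasure (P \<infinity>) (D k)" for k
  proof -
    have "(\<Sum>n\<in>{k..<N}. emeasure (P (enat k)) (D n)) = (\<Sum>n<N - k. emeasure (P (enat k)) (D (k + n)))"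
      by (rule sum.reindex_bij_witness[of _ "\<lambda>n. k + n" "\<lambda>n. n - k"]) auto
    also have "\<dots> \<le> (\<Sum>n. emeasure (P (enat k)) (D (k + n)))"
      by (intro sum_le_suminf) auto
    also have "\<dots> \<le> ?J * emeasure (P (enat k)) (D k)"
      unfolding D_eq[where \<nu> = "enat k"]
      by (rule suminf_enat_tail_le_pollak_delay)
         (use prob[of "enat k"] stopping_time_in_P[of _ "enat k"] in \<open>auto simp: D_eq[where \<nu> = "enat k"] prob_space_def\<close>)
    \<comment> \<open>The event T > k is decided by the first k observations, on which a change at k
      has no effect yet.\<close>
    also have "emeasure (P (enat k)) (D k) = emeasure (P \<infinity>) (D k)"
      using nn_integral_before_change[OF measurable_stopping_time[OF order_refl, of k], of "enat k"] stopping_time_in_P by simp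
    finally show ?thesis .
  qed
  have "(\<integral>\<^sup>+\<omega>. ennreal (1 + SR_stat L r n \<omega>) * indicator (D n) \<omega> \<partial>P \<infinity>) =
      ennreal r * emeasure (P 0) (D n) + (\<Sum>k\<le>n. emeasure (P (enat k)) (D n))" for n
  proof -
    note [measurable] = measurable_obs[OF measurable_SR[of r n], of \<infinity>]
    have "(\<integral>\<^sup>+\<omega>. ennreal (1 + SR_stat L r n \<omega>) * indicator (D n) \<omega> \<partial>P \<infinity>) =
        (\<integral>\<^sup>+\<omega>. ennreal (SR_stat L r n \<omega>) * indicator (D n) \<omega> + indicator (D n) \<omega> \<partial>P \<infinity>)"
      using SR_nonneg[OF r, of n]
      by (intro nn_integral_cong) (simp add: distrib_right add.commute)
    also have "\<dots> = (\<integral>\<^sup>+\<omega>. ennreal (SR_stat L r n \<omega>) * indicator (D n) \<omega> \<partial>P \<infinity>) +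
        (\<integral>\<^sup>+\<omega>. indicator (D n) \<omega> \<partial>P \<infinity>)"
      by (intro nn_integral_add borel_measurable_times_ennreal
          measurable_obs[OF measurable_stopping_time[OF order_refl]]) measurable
    also have "\<dots> = ennreal r * (\<integral>\<^sup>+\<omega>. indicator (D n) \<omega> \<partial>P 0) +
        (\<Sum>k<n. \<integral>\<^sup>+\<omega>. indicator (D n) \<omega> \<partial>P (enat k)) + (\<integral>\<^sup>+\<omega>. indicator (D n) \<omega> \<partial>P (enat n))"
      unfolding nn_integral_SR[OF measurable_stopping_time[OF order_refl] r]
      using nn_integral_before_change[OF measurable_stopping_time[OF order_refl], of n "enat n"] by simp
    finally show ?thesis
      using stopping_time_in_P by (simp add: lessThan_Suc_atMost[symmetric] add.assoc)
  qed
  then have "(\<Sum>n<N. \<integral>\<^sup>+\<omega>. ennreal (1 + SR_stat L r n \<omega>) * indicator (D n) \<omega> \<partial>P \<infinity>) =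
      ennreal r * (\<Sum>n<N. emeasure (P 0) (D n)) + (\<Sum>n<N. \<Sum>k\<le>n. emeasure (P (enat k)) (D n))"
    by (simp add: sum.distrib sum_distrib_left)
  also have "(\<Sum>n<N. \<Sum>k\<le>n. emeasure (P (enat k)) (D n)) = (\<Sum>k<N. \<Sum>n\<in>{k..<N}. emeasure (P (enat k)) (D n))"
    unfolding sum.Sigma[OF finite_lessThan ballI[OF finite_atMost]]
      sum.Sigma[OF finite_lessThan ballI[OF finite_atLeastLessThan]]
    by (rule sum.reindex_bij_witness[of _ "\<lambda>(a, b). (b, a)" "\<lambda>(a, b). (b, a)"]) auto
  also have "ennreal r * (\<Sum>n<N. emeasure (P 0) (D n)) + \<dots> \<le>
      ennreal r * ?J + (\<Sum>k<N. ?J * emeasure (P \<infinity>) (D k))"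
  proof (intro add_mono mult_left_mono sum_mono tail)
    interpret prob_space "P \<infinity>" by (rule prob)
    \<comment> \<open>The term with weight \<open>r\<close> is the delay for changepoint 0, where
      the probability of T > 0 is at most 1.\<close>
    have "(\<Sum>n<N. emeasure (P 0) (D n)) \<le> ?J * emeasure (P \<infinity>) (D 0)"
      using tail[of 0] by (simp add: zero_enat_def lessThan_atLeast0)
    also have "\<dots> \<le> ?J * 1" by (intro mult_left_mono) (simp_all add: emeasure_le_1)
    finally show "(\<Sum>n<N. emeasure (P 0) (D n)) \<le> ?J" by simp
  qed simp
  finally show ?thesis
    by (simp add: distrib_left sum_distrib_left mult.commute)
qed

end

text \<open>If the delay were j < d, the two sums would give l s \<le> j (r + s) + m for all partial
  sums s of the tail series of the mean. The mean is then finite and at most (j r + m) / (l - j);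
  being at least g, it forces l g - m \<le> j (r + g), whereas \<open>sr_gain_start\<close> gives l
  g - m = d (r + g).\<close>

lemma pollak_delay_lower_bound:
  assumes A: "0 < A" "A \<le> 2"
    and T: "stopping_time (obs_filtration (space (P \<infinity>)) X) T"
    and mean: "ennreal (1 + A / (2 * sqrt (1 + A)) / (1 - surv_pre A)) \<le> mean_time (P \<infinity>) T"
  shows "ennreal (sr_delay A) \<le> pollak_delay P T"
proof (rule ccontr)
  interpret prob_space "P \<infinity>" by (rule prob)
  define r where "r = sqrt (1 + A) - 1"
  define g where "g = 1 + A / (2 * sqrt (1 + A)) / (1 - surv_pre A)"
  define a where "a n = measure (P \<infinity>) {\<omega> \<in> space (P \<infinity>). T \<omega> > enat n}" for n
  define l where "l = sr_multiplier A"
  define m where "m = sr_gain A r"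
  have r: "0 \<le> r" using A by (simp add: r_def)
  have g: "1 \<le> g" using A surv_pre_less_1[of A] by (simp add: g_def)
  have a: "emeasure (P \<infinity>) {\<omega> \<in> space (P \<infinity>). T \<omega> > enat n} = ennreal (a n)" "0 \<le> a n" for n
    by (simp_all add: a_def emeasure_eq_measure)
  have d: "0 \<le> sr_delay A" using sr_delay_nonneg[of A] A by simp
  assume "\<not> ennreal (sr_delay A) \<le> pollak_delay P T"
  then have "pollak_delay P T < ennreal (sr_delay A)" by simp
  then obtain j where j: "pollak_delay P T = ennreal j" "0 \<le> j" "j < sr_delay A"
    using d by (cases "pollak_delay P T") (auto simp: ennreal_less_iff)
  have l: "j < l" "0 \<le> l" using j sr_delay_le_multiplier[OF A] by (auto simp: l_def)
  have m: "0 \<le> m" by (simp add: m_def sr_gain_nonneg)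
  have "(\<Sum>n<N. a n) \<le> (j * r + m) / (l - j)" for N
  proof -
    define s where "s = (\<Sum>n<N. a n)"
    have s: "(\<Sum>n<N. emeasure (P \<infinity>) {\<omega> \<in> space (P \<infinity>). T \<omega> > enat n}) = ennreal s" "0 \<le> s"
      by (simp_all add: a s_def sum_nonneg)
    have "ennreal l * ennreal s \<le> ennreal j * (ennreal r + ennreal s) + ennreal m"
      using bellman_sum[OF A r T, of N] add_right_mono[OF sum_SR_le_pollak_delay[OF A r T, of N]]
      unfolding s j l_def m_def by (rule order_trans)
    also have "\<dots> = ennreal (j * (r + s) + m)"
      using j r m s(2) by (simp add: ennreal_mult)
    finally have "l * s \<le> j * (r + s) + m"
      using j r m s(2) l by (simp del: ennreal_plus flip: ennreal_mult)
    then show ?thesis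
      using l by (simp add: s_def[symmetric] pos_le_divide_eq algebra_simps)
  qed
  then have "(\<Sum>n<N. ennreal (a n)) \<le> ennreal ((j * r + m) / (l - j))" for N
    using a(2) by (simp add: ennreal_leI)
  then have "(\<Sum>n. ennreal (a n)) \<le> ennreal ((j * r + m) / (l - j))"
    by (intro suminf_le_const) auto
  moreover have "mean_time (P \<infinity>) T = (\<Sum>n. ennreal (a n))"
  proof -
    have "{\<omega> \<in> space (P \<infinity>). T \<omega> > enat n} \<in> sets (P \<infinity>)" for n
      by (rule stopping_time_in_P[OF A r T])
    from mean_time_eq_suminf[OF this] show ?thesis by (simp add: a)
  qed
  ultimately have "ennreal g \<le> ennreal ((j * r + m) / (l - j))"
    using mean by (simp add: g_def)
  moreover have "0 \<le> (j * r + m) / (l - j)" using j r m l by simp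
  ultimately have "g \<le> (j * r + m) / (l - j)" by simp
  then have "l * g - m \<le> j * (r + g)"
    using l by (simp add: pos_le_divide_eq algebra_simps)
  moreover have "sr_delay A * (r + g) = l * g - m"
    using sr_gain_start[OF A] by (simp add: r_def g_def l_def m_def)
  ultimately have "sr_delay A * (r + g) \<le> j * (r + g)" by simp
  then have "sr_delay A \<le> j" using r g by simp
  with j show False by simp
qed

end

section \<open>The randomised start\<close>

definition uniform_law :: "real \<Rightarrow> real measure" where
  "uniform_law B = density lborel (\<lambda>x. ennreal (1 / B) * indicator {0<..<B} x)"

lemma sets_uniform_law [simp, measurable_cong]: "sets (uniform_law B) = sets borel"
  by (simp add: uniform_law_def)

lemma space_uniform_law [simp]: "space (uniform_law B) = UNIV"
  by (simp add: uniform_law_def)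

lemma nn_integral_uniform_law:
  assumes "0 < B" and [measurable]: "f \<in> borel_measurable borel"
    and "0 \<le> c" "0 \<le> v" "(\<integral>\<^sup>+x. f x * indicator {0<..<B} x \<partial>lborel) = ennreal v"
  shows "(\<integral>\<^sup>+x. ennreal c * f x \<partial>uniform_law B) = ennreal (c * v / B)"
proof -
  have "(\<integral>\<^sup>+x. ennreal c * f x \<partial>uniform_law B) =
      (\<integral>\<^sup>+x. (ennreal (1 / B) * ennreal c) * (f x * indicator {0<..<B} x) \<partial>lborel)"
    unfolding uniform_law_def
    by (subst nn_integral_density) (auto intro!: nn_integral_cong simp: mult_ac)
  also have "\<dots> = ennreal (1 / B) * ennreal c * ennreal v"
    by (simp only: assms(5)[symmetric]) (rule nn_integral_cmult, measurable)
  finally show ?thesis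
    using assms(1,3,4) by (simp flip: ennreal_mult)
qed

lemma real_distribution_uniform_law:
  assumes "0 < B"
  shows "real_distribution (uniform_law B)"
proof -
  have "(\<integral>\<^sup>+x. ennreal 1 * 1 \<partial>uniform_law B) = ennreal (1 * B / B)"
    using assms by (intro nn_integral_uniform_law) auto
  then have "prob_space (uniform_law B)"
    using assms by (intro prob_spaceI) simp
  then show ?thesis
    by (simp add: real_distribution_def real_distribution_axioms_def)
qed

section \<open>The quasi-stationary law and the randomised procedure\<close>

context exponential_model
begin

context
  fixes B :: real
  assumes B: "0 < B" "B \<le> 2"
begin

text \<open>From n = 1 on the surviving statistic is exactly uniform, so the sequence is constant;
  only n = 0, where the statistic is its start 0, must be skipped.\<close>

lemma quasi_stationary_limit:
  "(\<lambda>n. \<P>(\<omega> in P \<infinity>. SR_stat L 0 n \<omega> \<le> x \<bar> T_sr L 0 B \<omega> > enat n)) \<longlonglongrightarrow> cdf (uniform_law B) x"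
proof -
  interpret prob_space "P \<infinity>" by (rule prob)
  have p: "0 < surv_pre B" using B by (simp add: surv_pre_def)
  define v where "v = measure lborel ({..x} \<inter> {0<..<B})"
  have "emeasure lborel ({..x} \<inter> {0<..<B}) \<le> emeasure lborel {0<..<B}"
    by (intro emeasure_mono) auto
  then have "emeasure lborel ({..x} \<inter> {0<..<B}) < top"
    by (rule le_less_trans) (use B in simp)
  then have "emeasure lborel ({..x} \<inter> {0<..<B}) = ennreal v"
    by (simp add: v_def emeasure_eq_ennreal_measure less_top)
  moreover have "(\<integral>\<^sup>+y. indicator {..x} y * indicator {0<..<B} y \<partial>lborel) = emeasure lborel ({..x} \<inter> {0<..<B})"
    by (simp flip: indicator_inter_arith)
  ultimately have v: "(\<integral>\<^sup>+y. indicator {..x} y * indicator {0<..<B} y \<partial>lborel) = ennreal v" "0 \<le> v"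
    by (simp_all add: v_def)
  have "\<P>(\<omega> in P \<infinity>. SR_stat L 0 (Suc n) \<omega> \<le> x \<bar> T_sr L 0 B \<omega> > enat (Suc n)) = v / B" for n
  proof -
    have [measurable]: "SR_stat L 0 (Suc n) \<in> borel_measurable (P \<infinity>)"
      by (rule measurable_obs[OF measurable_SR])
    have "{\<omega> \<in> space (P \<infinity>). SR_stat L 0 (Suc n) \<omega> \<le> x \<and> T_sr L 0 B \<omega> > enat (Suc n)} =
        {\<omega> \<in> space (P \<infinity>). SR_stat L 0 (Suc n) \<omega> \<le> x} \<inter> {\<omega> \<in> space (P \<infinity>). T_sr L 0 B \<omega> > enat (Suc n)}"
      by auto
    also have "\<dots> \<in> sets (P \<infinity>)"
      by (intro sets.Int alive_in_P) measurable
    finally have "emeasure (P \<infinity>) {\<omega> \<in> space (P \<infinity>). SR_stat L 0 (Suc n) \<omega> \<le> x \<and> T_sr L 0 B \<omega> > enat (Suc n)} =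
        (\<integral>\<^sup>+\<omega>. indicator {\<omega> \<in> space (P \<infinity>). SR_stat L 0 (Suc n) \<omega> \<le> x \<and> T_sr L 0 B \<omega> > enat (Suc n)} \<omega> \<partial>P \<infinity>)"
      by simp
    also have "\<dots> = (\<integral>\<^sup>+\<omega>. indicator {..x} (SR_stat L 0 (Suc n) \<omega>) * indicator (alive 0 B (Suc n)) \<omega> \<partial>P \<infinity>)"
      by (intro nn_integral_cong) (simp add: indicator_def del: SR_stat.simps)
    also have "\<dots> = ennreal v * ennreal (surv_pre B ^ n / (2 * (1 + 0)))"
      using nn_integral_alive_before[of 0 B "indicator {..x}" n \<infinity>] B v by simp
    also have "\<dots> = ennreal (v * surv_pre B ^ n / 2)"
      using p v(2) by (simp flip: ennreal_mult)
    finally have 1: "prob {\<omega> \<in> space (P \<infinity>). SR_stat L 0 (Suc n) \<omega> \<le> x \<and> T_sr L 0 B \<omega> > enat (Suc n)} =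
        v * surv_pre B ^ n / 2"
      using p v(2) by (simp add: measure_def del: SR_stat.simps)
    have 2: "prob {\<omega> \<in> space (P \<infinity>). T_sr L 0 B \<omega> > enat (Suc n)} = B * surv_pre B ^ n / 2"
      using emeasure_alive_before[of 0 B n \<infinity>] p B by (simp add: measure_def)
    show ?thesis
      unfolding cond_prob_def 1 2 using p by simp
  qed
  then have "(\<lambda>n. \<P>(\<omega> in P \<infinity>. SR_stat L 0 (Suc n) \<omega> \<le> x \<bar> T_sr L 0 B \<omega> > enat (Suc n))) \<longlonglongrightarrow> v / B"
    by simp
  moreover have "cdf (uniform_law B) x = v / B"
  proof -
    have "(\<integral>\<^sup>+y. ennreal 1 * indicator {..x} y \<partial>uniform_law B) = ennreal (1 * v / B)"
      using B v by (intro nn_integral_uniform_law) auto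
    then show ?thesis
      using B v(2) by (simp add: cdf_def measure_def)
  qed
  ultimately show ?thesis
    by (intro LIMSEQ_imp_Suc[where f = "\<lambda>n. \<P>(\<omega> in P \<infinity>. SR_stat L 0 n \<omega> \<le> x \<bar> T_sr L 0 B \<omega> > enat n)"])
       (simp only:)
qed

text \<open>Limits are unique and a distribution function determines its law. This yields existence
  and uniqueness of \<open>Q\<close> at once.\<close>

lemma quasi_stationary_iff: "quasi_stationary (P \<infinity>) L B Q \<longleftrightarrow> Q = uniform_law B"
proof
  assume Q: "quasi_stationary (P \<infinity>) L B Q"
  then have "cdf Q = cdf (uniform_law B)"
    unfolding quasi_stationary_def using LIMSEQ_unique[OF _ quasi_stationary_limit] by blast
  then show "Q = uniform_law B"
    using Q real_distribution_uniform_law[OF B(1)] by (intro cdf_unique) (auto simp: quasi_stationary_def)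
next
  assume "Q = uniform_law B"
  then show "quasi_stationary (P \<infinity>) L B Q"
    using real_distribution_uniform_law[OF B(1)] quasi_stationary_limit by (simp add: quasi_stationary_def)
qed

lemma T_srp_gt_in_sets:
  "{z \<in> space (randomized (uniform_law B) P \<nu>). T_srp L B z > enat n} \<in> sets (randomized (uniform_law B) P \<nu>)"
proof -
  have S: "sets (randomized (uniform_law B) P \<nu>) = sets (borel \<Otimes>\<^sub>M P \<nu>)"
    unfolding randomized_def by (intro sets_pair_measure_cong) simp_all
  have [measurable]: "(\<lambda>z. SR_stat L (fst z) k (snd z)) \<in> borel_measurable (borel \<Otimes>\<^sub>M P \<nu>)" for k
    using measurable_SR_pair[of k \<nu>] by (simp add: case_prod_beta)
  have "{z \<in> space (borel \<Otimes>\<^sub>M P \<nu>). \<forall>k\<in>{1..n}. SR_stat L (fst z) k (snd z) < B} \<in> sets (borel \<Otimes>\<^sub>M P \<nu>)"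
    by measurable
  then show ?thesis
    unfolding S sets_eq_imp_space_eq[OF S] by (simp add: T_srp_def case_prod_beta T_sr_gt_iff)
qed

lemma emeasure_T_srp_gt:
  "emeasure (randomized (uniform_law B) P \<nu>) {z \<in> space (randomized (uniform_law B) P \<nu>). T_srp L B z > enat n} =
    (\<integral>\<^sup>+r. emeasure (P \<nu>) {\<omega> \<in> space (P \<nu>). T_sr L r B \<omega> > enat n} \<partial>uniform_law B)"
proof -
  interpret prob_space "P \<nu>" by (rule prob)
  have "Pair r -` {z \<in> space (uniform_law B \<Otimes>\<^sub>M P \<nu>). T_srp L B z > enat n} =
      {\<omega> \<in> space (P \<nu>). T_sr L r B \<omega> > enat n}" for r
    by (auto simp: space_pair_measure T_srp_def)
  then show ?thesis
    using T_srp_gt_in_sets[of \<nu> n] unfolding randomized_def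
    by (subst emeasure_pair_measure_alt) simp_all
qed

text \<open>The survival formulas assume a nonnegative start, so they are inserted only almost
  everywhere under the integral over starts.\<close>

lemma AE_uniform_law_nonneg: "AE r in uniform_law B. 0 \<le> r"
  unfolding uniform_law_def by (subst AE_density) (auto simp: indicator_def)

text \<open>Averaging the start-dependent factor 1 / (2 (1 + r)) over the uniform law gives
  \<open>surv_pre B / B\<close>, that is, one further factor \<open>surv_pre B\<close>. Survival is
  thus geometric from the very first step.\<close>

lemma emeasure_T_srp_gt_before:
  assumes "enat n \<le> \<nu>"
  shows "emeasure (randomized (uniform_law B) P \<nu>) {z \<in> space (randomized (uniform_law B) P \<nu>). T_srp L B z > enat n} =
    ennreal (surv_pre B ^ n)"
proof (cases n)
  case 0
  interpret real_distribution "uniform_law B" by (rule real_distribution_uniform_law[OF B(1)])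
  have "(\<integral>\<^sup>+r. emeasure (P \<nu>) {\<omega> \<in> space (P \<nu>). T_sr L r B \<omega> > enat 0} \<partial>uniform_law B) =
      (\<integral>\<^sup>+r. 1 \<partial>uniform_law B)"
    by (intro nn_integral_cong_AE, use AE_uniform_law_nonneg in eventually_elim)
       (use emeasure_alive_0 B in simp)
  then show ?thesis unfolding emeasure_T_srp_gt 0 using emeasure_space_1 by simp
next
  case (Suc k)
  have p: "0 \<le> surv_pre B" using surv_pre_nonneg B by simp
  have "(\<integral>\<^sup>+r. emeasure (P \<nu>) {\<omega> \<in> space (P \<nu>). T_sr L r B \<omega> > enat n} \<partial>uniform_law B) =
      (\<integral>\<^sup>+r. ennreal (B * surv_pre B ^ k) * ennreal (1 / (2 * (1 + r))) \<partial>uniform_law B)"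
  proof (intro nn_integral_cong_AE, use AE_uniform_law_nonneg in eventually_elim)
    fix r :: real assume "0 \<le> r"
    then show "emeasure (P \<nu>) {\<omega> \<in> space (P \<nu>). T_sr L r B \<omega> > enat n} =
        ennreal (B * surv_pre B ^ k) * ennreal (1 / (2 * (1 + r)))"
      using emeasure_alive_before[of r B k \<nu>] assms B p Suc by (simp flip: ennreal_mult)
  qed
  also have "\<dots> = ennreal (B * surv_pre B ^ k * surv_pre B / B)"
    using B p nn_integral_Ioo_recip[of B] by (intro nn_integral_uniform_law) auto
  finally show ?thesis unfolding emeasure_T_srp_gt using B Suc by (simp add: mult.commute)
qed

text \<open>For m = 0 the start itself is uniform at the change, for m > 0 the surviving statistic
  is; both cases give the same first-step factor.\<close>

lemma emeasure_T_srp_gt_after: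
  "emeasure (randomized (uniform_law B) P (enat m))
      {z \<in> space (randomized (uniform_law B) P (enat m)). T_srp L B z > enat (m + Suc j)} =
    ennreal (surv_pre B ^ m * (B\<^sup>2 / (4 * (1 + B))) * surv_post B ^ j)"
proof -
  have p: "0 \<le> surv_pre B" "0 \<le> surv_post B" using surv_pre_nonneg surv_post_nonneg B by simp_all
  show ?thesis
  proof (cases m)
    case 0
    have "(\<integral>\<^sup>+r. emeasure (P (enat m)) {\<omega> \<in> space (P (enat m)). T_sr L r B \<omega> > enat (m + Suc j)} \<partial>uniform_law B) =
        (\<integral>\<^sup>+r. ennreal (B\<^sup>2 / 2 * surv_post B ^ j) * ennreal (1 / (2 * (1 + r)\<^sup>2)) \<partial>uniform_law B)"
    proof (intro nn_integral_cong_AE, use AE_uniform_law_nonneg in eventually_elim)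
      fix r :: real assume "0 \<le> r"
      then show "emeasure (P (enat m)) {\<omega> \<in> space (P (enat m)). T_sr L r B \<omega> > enat (m + Suc j)} =
          ennreal (B\<^sup>2 / 2 * surv_post B ^ j) * ennreal (1 / (2 * (1 + r)\<^sup>2))"
        using emeasure_alive_after_0[of r B j] B p 0 by (simp add: mult_ac flip: ennreal_mult)
    qed
    also have "\<dots> = ennreal (B\<^sup>2 / 2 * surv_post B ^ j * (B / (2 * (1 + B))) / B)"
      using B p nn_integral_Ioo_recip_square[of B] by (intro nn_integral_uniform_law) auto
    finally show ?thesis unfolding emeasure_T_srp_gt using B 0 by (simp add: mult_ac)
  next
    case (Suc n)
    let ?c = "B * surv_pre B ^ n * (B\<^sup>2 / (4 * (1 + B))) * surv_post B ^ j"
    have "(\<integral>\<^sup>+r. emeasure (P (enat m)) {\<omega> \<in> space (P (enat m)). T_sr L r B \<omega> > enat (m + Suc j)} \<partial>uniform_law B) =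
        (\<integral>\<^sup>+r. ennreal ?c * ennreal (1 / (2 * (1 + r))) \<partial>uniform_law B)"
    proof (intro nn_integral_cong_AE, use AE_uniform_law_nonneg in eventually_elim)
      fix r :: real assume r: "0 \<le> r"
      have "B * surv_pre B ^ n / (2 * (1 + r)) * (B\<^sup>2 / (4 * (1 + B))) * surv_post B ^ j = ?c * (1 / (2 * (1 + r)))"
        by (simp add: mult_ac)
      then show "emeasure (P (enat m)) {\<omega> \<in> space (P (enat m)). T_sr L r B \<omega> > enat (m + Suc j)} =
          ennreal ?c * ennreal (1 / (2 * (1 + r)))"
        unfolding Suc emeasure_alive_after_Suc[OF r B]
        by (subst ennreal_mult[symmetric]) (use B p r in simp_all)
    qed
    also have "\<dots> = ennreal (?c * surv_pre B / B)"
      using B p nn_integral_Ioo_recip[of B] by (intro nn_integral_uniform_law) auto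
    finally show ?thesis unfolding emeasure_T_srp_gt using B Suc by (simp add: mult_ac)
  qed
qed

lemma mean_time_T_srp:
  "mean_time (randomized (uniform_law B) P \<infinity>) (T_srp L B) = ennreal (1 / (1 - surv_pre B))"
proof -
  have p: "0 \<le> surv_pre B" "surv_pre B < 1" using surv_pre_nonneg surv_pre_less_1 B by simp_all
  have "(\<Sum>n. ennreal (surv_pre B ^ n)) = ennreal (1 / (1 - surv_pre B))"
    using p by (intro suminf_ennreal_eq geometric_sums) auto
  then show ?thesis
    unfolding mean_time_eq_suminf[OF T_srp_gt_in_sets] by (simp add: emeasure_T_srp_gt_before)
qed

lemma pollak_delay_T_srp:
  "pollak_delay (randomized (uniform_law B) P) (T_srp L B) = ennreal (sr_delay B)"
proof -
  let ?M = "randomized (uniform_law B) P"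
  have p: "0 < surv_pre B" using B by (simp add: surv_pre_def)
  have cd: "cond_delay (?M (enat \<nu>)) (T_srp L B) \<nu> = ennreal (sr_delay B)" for \<nu>
    by (rule cond_delay_geometric[where s = "surv_pre B ^ \<nu>"])
       (use B p T_srp_gt_in_sets emeasure_T_srp_gt_before[of \<nu> "enat \<nu>"] emeasure_T_srp_gt_after in simp_all)
  have "emeasure (?M (enat 0)) {z \<in> space (?M (enat 0)). T_srp L B z > enat 0} > 0"
    using emeasure_T_srp_gt_before[of 0 "enat 0"] by simp
  then have "{\<nu>::nat. emeasure (?M (enat \<nu>)) {z \<in> space (?M (enat \<nu>)). T_srp L B z > enat \<nu>} > 0} \<noteq> {}"
    by blast
  then show ?thesis
    unfolding pollak_delay_def cd by (rule SUP_const)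
qed

end

end

section \<open>Comparison of the thresholds\<close>

text \<open>The difference of the two sides vanishes at 1 and has derivative (1 - 1 / x)^2.\<close>

lemma two_ln_less:
  assumes "1 < (s::real)"
  shows "2 * ln s < s - 1 / s"
proof -
  let ?f = "\<lambda>s::real. s - 1 / s - 2 * ln s"
  have "?f 1 < ?f s"
  proof (rule DERIV_pos_imp_increasing_open[OF assms])
    fix x :: real assume x: "1 < x" "x < s"
    have "(?f has_real_derivative 1 + 1 / x\<^sup>2 - 2 * (1 / x)) (at x)"
      using x by (auto intro!: derivative_eq_intros simp: power2_eq_square)
    moreover have "1 + 1 / x\<^sup>2 - 2 * (1 / x) = (1 - 1 / x)\<^sup>2"
      by (simp add: power2_diff power_divide)
    moreover have "0 < (1 - 1 / x)\<^sup>2" using x by simp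
    ultimately show "\<exists>y. DERIV ?f x :> y \<and> 0 < y" by metis
  qed (auto intro!: continuous_intros)
  then show ?thesis by simp
qed

text \<open>\<open>surv_post\<close> is the integral of a nonnegative function over (0, A), hence
  monotone without differentiation; strictness comes from the factor A^2 / (4 (1 + A)).\<close>

lemma sr_delay_strict_mono:
  assumes "0 < A" "A < B" "B \<le> 2"
  shows "sr_delay A < sr_delay B"
proof -
  have "ennreal (surv_post A) \<le> ennreal (surv_post B)"
    using assms unfolding nn_integral_Ioo_id_recip_square[symmetric, of A, OF less_imp_le[OF assms(1)]]
    by (subst nn_integral_Ioo_id_recip_square[symmetric])
       (auto intro!: nn_integral_mono simp: indicator_def)
  then have q: "surv_post A \<le> surv_post B" "surv_post B < 1"
    using surv_post_nonneg[of B] surv_post_less_1[of B] assms by auto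
  have "A\<^sup>2 / (4 * (1 + A)) < B\<^sup>2 / (4 * (1 + B))" (is "?u < ?v")
  proof -
    have "A\<^sup>2 < B\<^sup>2" using assms by (intro power_strict_mono) auto
    moreover have "A * B * A \<le> A * B * B" using assms by (intro mult_left_mono) auto
    ultimately have "A\<^sup>2 * (4 * (1 + B)) < B\<^sup>2 * (4 * (1 + A))"
      by (simp add: power2_eq_square algebra_simps)
    then show ?thesis using assms by (simp add: divide_less_eq less_divide_eq mult_ac)
  qed
  moreover have "0 \<le> ?u" using assms by simp
  ultimately have "?u / (1 - surv_post A) < ?v / (1 - surv_post B)"
    using q by (simp only: frac_less diff_left_mono diff_gt_0_iff_gt)
  then show ?thesis by (simp add: sr_delay_def)
qed

text \<open>For \<open>A \<le> 2\<close> this form says that the no-change mean from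
  \<open>mean_time_T_sr\<close>, with 1 + r = sqrt (1 + A), equals \<gamma>.\<close>

lemma threshold_eq_iff:
  assumes "0 < A"
  shows "threshold_eq \<gamma> A \<longleftrightarrow> A / sqrt (1 + A) = (\<gamma> - 1) * (2 * (1 - surv_pre A))"
proof -
  have "sqrt (1 + A) \<noteq> 0" using assms by simp
  then show ?thesis
    unfolding divide_eq_eq threshold_eq_def surv_pre_def by (auto simp: algebra_simps)
qed

lemma surv_pre_eq_ln_sqrt: "0 \<le> A \<Longrightarrow> surv_pre A = ln (sqrt (1 + A))"
  by (simp add: surv_pre_def ln_sqrt)

lemma two_surv_pre_less:
  assumes "0 < A"
  shows "2 * surv_pre A < A / sqrt (1 + A)"
proof -
  define s where "s = sqrt (1 + A)"
  have s: "1 < s" "A = s\<^sup>2 - 1" using assms by (auto simp: s_def)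
  have "2 * ln s < s - 1 / s" by (rule two_ln_less[OF s(1)])
  also have "s - 1 / s = A / s" using s by (simp add: power2_eq_square field_simps)
  finally show ?thesis using surv_pre_eq_ln_sqrt[of A] assms by (simp add: s_def)
qed

text \<open>In the form of \<open>threshold_eq_iff\<close> the left side, which is s - 1 / s with s
  = sqrt (1 + A), strictly increases in A, while the right side does not increase.\<close>

lemma threshold_eq_unique:
  assumes "1 < \<gamma>" "0 < A" "threshold_eq \<gamma> A" "0 < A'" "threshold_eq \<gamma> A'"
  shows "A = A'"
proof -
  have "\<not> A < A'" if "0 < A" "threshold_eq \<gamma> A" "0 < A'" "threshold_eq \<gamma> A'" for A A'
  proof
    assume "A < A'"
    have root: "C / sqrt (1 + C) = sqrt (1 + C) - 1 / sqrt (1 + C)" if "0 < C" for C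
    proof -
      have "sqrt (1 + C) * sqrt (1 + C) = 1 + C" using that by simp
      then show ?thesis using that by (simp add: divide_simps)
    qed
    have "sqrt (1 + A) < sqrt (1 + A')" using \<open>A < A'\<close> by simp
    moreover from this have "1 / sqrt (1 + A') \<le> 1 / sqrt (1 + A)"
      using that by (intro divide_left_mono) auto
    ultimately have "A / sqrt (1 + A) < A' / sqrt (1 + A')" unfolding root[OF that(1)] root[OF that(3)] by linarith
    moreover have "surv_pre A \<le> surv_pre A'" using \<open>A < A'\<close> that by (simp add: surv_pre_def)
    then have "(\<gamma> - 1) * (2 * (1 - surv_pre A')) \<le> (\<gamma> - 1) * (2 * (1 - surv_pre A))"
      using assms(1) by (intro mult_left_mono) auto
    ultimately show False
      using threshold_eq_iff[OF that(1), of \<gamma>] threshold_eq_iff[OF that(3), of \<gamma>] that(2,4) by linarith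
  qed
  from this[OF assms(2-5)] this[OF assms(4,5,2,3)] show ?thesis by simp
qed

lemma ln_3_less_2: "ln 3 < (2::real)"
  using ln_add_one_self_less_self[of "2::real"] by simp

text \<open>The left side will be \<open>surv_pre B\<close> and the right side is
  \<open>surv_pre 2\<close>, so this keeps the threshold B within reach of the uniform-step
  argument.\<close>

lemma gamma_bound:
  assumes "1 < \<gamma>" "\<gamma> < inverse (1 - ln 3 / 2 :: real)"
  shows "(\<gamma> - 1) / \<gamma> < ln 3 / 2"
proof -
  have "\<gamma> * (1 - ln 3 / 2) < 1"
    using assms ln_3_less_2 by (simp add: inverse_eq_divide less_divide_eq)
  then show ?thesis using assms by (simp add: divide_less_eq algebra_simps)
qed

text \<open>Intermediate values on [0, 2]: the function is negative at 0, and at 2 it equals 2 -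
  sqrt 3 (\<gamma> - 1) (2 - ln 3). The bound on \<gamma> makes this at least 2 - sqrt 3 ln 3,
  positive by \<open>two_surv_pre_less\<close> at 2.\<close>

lemma threshold_eq_exists:
  assumes "1 < \<gamma>" "\<gamma> < inverse (1 - ln 3 / 2 :: real)"
  shows "\<exists>A. 0 < A \<and> A \<le> 2 \<and> threshold_eq \<gamma> A"
proof -
  let ?f = "\<lambda>A. A + (\<gamma> - 1) * sqrt (1 + A) * ln (1 + A) - 2 * (\<gamma> - 1) * sqrt (1 + A)"
  have "sqrt 3 * ln 3 < (2 :: real)"
  proof -
    have "ln 3 < 2 / sqrt (3::real)"
      using two_surv_pre_less[of 2] by (simp add: surv_pre_def)
    then show ?thesis by (simp add: less_divide_eq mult.commute)
  qed
  moreover have "(\<gamma> - 1) * (2 - ln 3) \<le> ln 3"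
    using gamma_bound[OF assms] assms by (simp add: divide_less_eq algebra_simps)
  then have "sqrt 3 * ((\<gamma> - 1) * (2 - ln 3)) \<le> sqrt 3 * ln 3"
    by (intro mult_left_mono) auto
  ultimately have "0 \<le> ?f 2" by (simp add: algebra_simps)
  moreover have "?f 0 \<le> 0" using assms by simp
  ultimately have "\<exists>A\<ge>0. A \<le> 2 \<and> ?f A = 0"
    by (intro IVT'[of ?f]) (auto intro!: continuous_intros)
  then obtain A where A: "0 \<le> A" "A \<le> 2" "?f A = 0" by blast
  moreover have "A \<noteq> 0" using A(3) assms by auto
  ultimately show ?thesis by (auto simp: threshold_eq_def intro!: exI[of _ A])
qed

theorem theorem2:
  fixes P :: "enat \<Rightarrow> 'a measure" and X :: "nat \<Rightarrow> 'a \<Rightarrow> real" and \<gamma> :: real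
  assumes "changepoint_model P X pre_density post_density"
    and "1 < \<gamma>" and "\<gamma> < inverse (1 - ln 3 / 2)"
  shows "(\<exists>!A. A > 0 \<and> threshold_eq \<gamma> A) \<and>
    (\<forall>A. A > 0 \<and> threshold_eq \<gamma> A \<longrightarrow>
      (let L = likelihood_ratio pre_density post_density X;
           T = T_sr L (sqrt (1 + A) - 1) A;
           opt = (INF S\<in>{S. stopping_time (obs_filtration (space (P \<infinity>)) X) S \<and>
                             mean_time (P \<infinity>) S \<ge> ennreal \<gamma>}. pollak_delay P S);
           B = exp (2 * (\<gamma> - 1) / \<gamma>) - 1
       in mean_time (P \<infinity>) T = ennreal \<gamma> \<and>
          pollak_delay P T = opt \<and>
          (\<exists>!Q. quasi_stationary (P \<infinity>) L B Q) \<and>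
          (\<forall>Q. quasi_stationary (P \<infinity>) L B Q \<longrightarrow>
             mean_time (randomized Q P \<infinity>) (T_srp L B) = ennreal \<gamma> \<and>
             pollak_delay (randomized Q P) (T_srp L B) > pollak_delay P T \<and>
             pollak_delay (randomized Q P) (T_srp L B) > opt)))"
proof -
  interpret exponential_model P X
    using assms(1) by (rule exponential_model.intro)
  obtain A0 where A0: "0 < A0" "A0 \<le> 2" "threshold_eq \<gamma> A0"
    using threshold_eq_exists[OF assms(2,3)] by blast
  \<comment> \<open>Every positive solution coincides with \<open>A0\<close> and so inherits
    \<open>A0 \<le> 2\<close>.\<close>
  have unique: "A = A0" if "A > 0" "threshold_eq \<gamma> A" for A
    by (rule threshold_eq_unique[OF assms(2) that A0(1,3)])
  define r where "r = sqrt (1 + A0) - 1"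
  define B where "B = exp (2 * (\<gamma> - 1) / \<gamma>) - 1"
  define opt where "opt = (INF S\<in>{S. stopping_time (obs_filtration (space (P \<infinity>)) X) S \<and>
    mean_time (P \<infinity>) S \<ge> ennreal \<gamma>}. pollak_delay P S)"
  have r: "0 \<le> r" "1 + r = sqrt (1 + A0)" using A0 by (auto simp: r_def)
  have p: "surv_pre A0 < 1" using surv_pre_less_1[of A0] A0 by simp
  have sol: "A0 / sqrt (1 + A0) = (\<gamma> - 1) * (2 * (1 - surv_pre A0))"
    using threshold_eq_iff[OF A0(1)] A0(3) by blast
  have "A0 / (2 * sqrt (1 + A0)) / (1 - surv_pre A0) = A0 / sqrt (1 + A0) / (2 * (1 - surv_pre A0))"
    by (simp add: mult_ac)
  also have "\<dots> = \<gamma> - 1" unfolding sol using p by simp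
  finally have frac: "A0 / (2 * sqrt (1 + A0)) / (1 - surv_pre A0) = \<gamma> - 1" .
  have mean: "mean_time (P \<infinity>) (T_sr L r A0) = ennreal \<gamma>"
    unfolding mean_time_T_sr[OF r(1) A0(1,2)] r(2) frac by simp
  have delay: "pollak_delay P (T_sr L r A0) = ennreal (sr_delay A0)"
    unfolding r_def by (rule pollak_delay_T_sr[OF A0(1,2)])
  have optimal: "opt = ennreal (sr_delay A0)"
    unfolding opt_def
  proof (rule antisym)
    show "(INF S\<in>{S. stopping_time (obs_filtration (space (P \<infinity>)) X) S \<and>
        mean_time (P \<infinity>) S \<ge> ennreal \<gamma>}. pollak_delay P S) \<le> ennreal (sr_delay A0)"
      unfolding delay[symmetric] by (rule INF_lower) (simp add: stopping_time_T_sr mean)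
    show "ennreal (sr_delay A0) \<le> (INF S\<in>{S. stopping_time (obs_filtration (space (P \<infinity>)) X) S \<and>
        mean_time (P \<infinity>) S \<ge> ennreal \<gamma>}. pollak_delay P S)"
    proof (rule INF_greatest, elim CollectE conjE)
      fix S :: "'a \<Rightarrow> enat"
      assume S: "stopping_time (obs_filtration (space (P \<infinity>)) X) S" "ennreal \<gamma> \<le> mean_time (P \<infinity>) S"
      show "ennreal (sr_delay A0) \<le> pollak_delay P S"
        using pollak_delay_lower_bound[OF A0(1,2) S(1), unfolded frac] S(2) by simp
    qed
  qed
  \<comment> \<open>\<open>B\<close> is made for this value, since it gives
    \<open>1 / (1 - surv_pre B) = \<gamma>\<close>.\<close>
  have pB: "surv_pre B = (\<gamma> - 1) / \<gamma>"
    using assms(2) by (simp add: B_def surv_pre_def field_simps)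
  have B: "0 < B" "B \<le> 2"
  proof -
    show "0 < B" using assms(2) by (simp add: B_def)
    have "2 * ((\<gamma> - 1) / \<gamma>) \<le> ln 3" using gamma_bound[OF assms(2,3)] by linarith
    then have "exp (2 * (\<gamma> - 1) / \<gamma>) \<le> exp (ln 3)"
      by (simp only: exp_le_cancel_iff times_divide_eq_right)
    then show "B \<le> 2" by (simp add: B_def)
  qed
  \<comment> \<open>With p = \<open>surv_pre A0\<close>, the threshold equation and
    \<open>two_surv_pre_less\<close> give p < (\<gamma> - 1) (1 - p), that is, p < (\<gamma> - 1) /
    \<gamma> = \<open>surv_pre B\<close>.\<close>
  have "A0 < B"
  proof -
    have "2 * surv_pre A0 < 2 * ((\<gamma> - 1) * (1 - surv_pre A0))"
      using two_surv_pre_less[OF A0(1)] unfolding sol by (simp only: mult.left_commute)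
    then have "surv_pre A0 < surv_pre B"
      using assms(2) by (simp add: pB less_divide_eq algebra_simps)
    then show ?thesis using A0(1) B(1) by (simp add: surv_pre_def)
  qed
  then have less: "ennreal (sr_delay A0) < ennreal (sr_delay B)"
    using sr_delay_strict_mono[of A0 B] A0 B sr_delay_nonneg[of A0] by (simp add: ennreal_less_iff)
  have "1 / (1 - surv_pre B) = \<gamma>" using assms(2) by (simp add: pB field_simps)
  then have mean_srp: "mean_time (randomized (uniform_law B) P \<infinity>) (T_srp L B) = ennreal \<gamma>"
    using mean_time_T_srp[OF B] by simp
  have main: "mean_time (P \<infinity>) (T_sr L r A0) = ennreal \<gamma> \<and> pollak_delay P (T_sr L r A0) = opt \<and>
      (\<exists>!Q. quasi_stationary (P \<infinity>) L B Q) \<and>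
      (\<forall>Q. quasi_stationary (P \<infinity>) L B Q \<longrightarrow>
        mean_time (randomized Q P \<infinity>) (T_srp L B) = ennreal \<gamma> \<and>
        pollak_delay (randomized Q P) (T_srp L B) > pollak_delay P (T_sr L r A0) \<and>
        pollak_delay (randomized Q P) (T_srp L B) > opt)"
    using mean delay optimal mean_srp less pollak_delay_T_srp[OF B]
    by (simp add: quasi_stationary_iff[OF B])
  show ?thesis
  proof (intro conjI allI impI)
    show "\<exists>!A. A > 0 \<and> threshold_eq \<gamma> A" using A0 unique by blast
  next
    fix A assume "A > 0 \<and> threshold_eq \<gamma> A"
    then have "A = A0" using unique by blast
    from main show "let L = likelihood_ratio pre_density post_density X;
           T = T_sr L (sqrt (1 + A) - 1) A;
           opt = (INF S\<in>{S. stopping_time (obs_filtration (space (P \<infinity>)) X) S \<and>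
                             mean_time (P \<infinity>) S \<ge> ennreal \<gamma>}. pollak_delay P S);
           B = exp (2 * (\<gamma> - 1) / \<gamma>) - 1
       in mean_time (P \<infinity>) T = ennreal \<gamma> \<and>
          pollak_delay P T = opt \<and>
          (\<exists>!Q. quasi_stationary (P \<infinity>) L B Q) \<and>
          (\<forall>Q. quasi_stationary (P \<infinity>) L B Q \<longrightarrow>
             mean_time (randomized Q P \<infinity>) (T_srp L B) = ennreal \<gamma> \<and>
             pollak_delay (randomized Q P) (T_srp L B) > pollak_delay P T \<and>
             pollak_delay (randomized Q P) (T_srp L B) > opt)"
      unfolding Let_def r_def B_def opt_def \<open>A = A0\<close> .
  qed
qed

end
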